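(* Let $K\in\mathbb{R}^{m\times n}$, $f=f_1+f_2$ on $\mathbb{R}^n$, $g=g_1+g_2$ on $\mathbb{R}^m$, and $\mathcal{L}(x,y)=f(x)+\langle Kx,y\rangle-g(y)$. Assume that $f_1:\mathbb{R}^n\to\mathbb{R}\cup\{+\infty\}$ is proper, closed and convex; $g_1:\mathbb{R}^m\to\mathbb{R}\cup\{+\infty\}$ is proper, closed and $\mu_g$-strongly convex with $\mu_g>0$; $f_2:\mathbb{R}^n\to\mathbb{R}$ is convex and differentiable with $L_{f_2}$-Lipschitz continuous gradient; $g_2:\mathbb{R}^m\to\mathbb{R}$ is convex and differentiable with $L_{g_2}$-Lipschitz continuous gradient ($L_{f_2},L_{g_2}>0$); and the set $\Omega$ of saddle points of $\mathcal{L}$ is nonempty. Let $\{(x_k,y_k,u_k,v_k)\}_{k\ge1}$ be the sequence generated by the inertial accelerated primal-dual algorithm described in the context (with either Option 1 or Option 2), with parameters $\alpha,\beta>0$, $t_1\ge 1$ satisfying $$\alpha\beta\|K\|^2<(1-\alpha L_{f_2})\left(1-\frac{\beta L_{g_2}}{t_1^2}\right),\qquad \alpha<\frac{1}{L_{f_2}},\qquad \beta<\frac{t_1^2}{L_{g_2}}.$$ For $(x,y)\in\mathbb{R}^n\times\mathbb{R}^m$ put $$\mathcal{E}_1(x,y)=t_1^2\big(\mathcal{L}(x_1,y)-\mathcal{L}(x,y_1)\big)+\frac{1}{2\alpha}\|x_1-x\|^2+\frac{t_2^2}{2\beta}\|y_1-y\|^2 .$$ Let $(x^*,y^* )\in\Omega$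 (the component $y^*$ is unique). Then the following hold. (a) For all $k\ge1$, $$\mathcal{L}(x_k,y^* )-\mathcal{L}(x^*,y_k)\le\frac{\mathcal{E}_1(x^*,y^* )}{t_k^2}.$$ Moreover, when $\beta\mu_g>1+1/t_1$, for any compact set $\mathcal{B}_1\times\mathcal{B}_2\subset\mathbb{R}^n\times\mathbb{R}^m$ containing a saddle point of $\mathcal{L}$ and all $k\ge1$, $$\mathcal{G}_{\mathcal{B}_1\times\mathcal{B}_2}(x_k,y_k)\le\frac{D(\mathcal{B}_1,\mathcal{B}_2)}{t_k^2},\qquad D(\mathcal{B}_1,\mathcal{B}_2)=\max_{x\in\mathcal{B}_1,\,y\in\mathcal{B}_2}\mathcal{E}_1(x,y).$$ (b) The sequence $\{(x_k,y_k,u_k,v_k)\}_{k\ge1}$ is bounded, and for all $k\ge1$ $$\|y_k-y^*\|^2\le\frac{2\mathcal{E}_1(x^*,y^* )}{\mu_g t_k^2},\qquad \|v_k-y^*\|^2\le\frac{2\beta\,\mathcal{E}_1(x^*,y^* )}{t_{k+1}^2},$$ $$\|x_k-x_{k-1}\|\le\mathcal{O}\left(\frac1{t_k}\right),\qquad \|y_k-y_{k-1}\|\le\mathcal{O}\left(\frac1{t_k^2}\right).$$ (c) When $\beta\mu_g>1+1/t_1$, every limit point of $\{(x_k,y_k)\}_{k\ge1}$ is a saddle point of $\mathcal{L}$.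
   Context: **Conventions.** $\|\cdot\|$ is the Euclidean norm (and $\|K\|$ the induced operator norm). For $h:\mathbb{R}^d\to\mathbb{R}\cup\{+\infty\}$, $dom(h)=\{x: h(x)<+\infty\}$; $h$ is proper if $dom(h)\ne\emptyset$; $h$ is closed if $h(x)\le\liminf_{y\to x}h(y)$ for all $x$ and $dom(h)$ is a closed set. $g_1$ is $\mu_g$-strongly convex: $g_1(y_2)-g_1(y_1)-\langle w,y_2-y_1\rangle\ge\frac{\mu_g}{2}\|y_2-y_1\|^2$ for all $y_1,y_2$ and all $w\in\partial g_1(y_1)$. For $\gamma>0$ the proximal operator is $\mathbf{Prox}_{\gamma,h}(x)=\arg\min_y\{h(y)+\frac1{2\gamma}\|y-x\|^2\}$. If $L_{f_2}$ (resp. $L_{g_2}$) is a Lipschitz constant it may be any valid positive constant (e.g. any positive number if $f_2\equiv0$, resp. $g_2\equiv 0$). $\mathcal{O}(1/t_k)$ and $\mathcal{O}(1/t_k^2)$ denote bounds $C/t_k$, $C/t_k^2$ with $C$ independent of $k$. **Saddle points.** The problem is $\min_{x\in\mathbb{R}^n}\max_{y\in\mathbb{R}^m}\mathcal{L}(x,y)$. $\Omega$ is the set of $(x^*,y^* )\in dom(f)\times dom(g)$ with $\mathcal{L}(x^*,y)\le\mathcal{L}(x^*,y^* )\le\mathcal{L}(x,y^* )$ for all $(x,y)\in\mathbb{R}^n\times\mathbb{R}^m$. For $x\in dom(f)$, $y\in dom(g)$, values are in the extended reals: $\mathcal{L}(x,\bar y)=-\infty$ if $\bar y\notin dom(g)$,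 and $\mathcal{L}(\bar x,y)=+\infty$ if $\bar x\notin dom(f)$. **Partial primal-dual gap.** For a compact set $\mathcal{B}_1\times\mathcal{B}_2$ containing a saddle point, $\mathcal{G}_{\mathcal{B}_1\times\mathcal{B}_2}(x,y)=\max_{\bar y\in\mathcal{B}_2}\mathcal{L}(x,\bar y)-\min_{\bar x\in\mathcal{B}_1}\mathcal{L}(\bar x,y)$. **Algorithm (inertial accelerated primal-dual algorithm).** Choose $u_1=x_1=x_0\in dom(f)$, $v_1=v_0=y_1=y_0\in dom(g)$, $\alpha,\beta>0$, $t_1\ge1$. Choose one of the two options below (fixed for the run). For $k=1,2,\dots$ (run indefinitely): 1. $t_{k+1}=\min\left\{\frac{1+\sqrt{1+4t_k^2}}{2},\ \sqrt{t_k^2+\mu_g\beta t_k}\right\}$. 2. $(\bar x_k,\bar y_k)=(x_k,y_k)+\frac{t_k-1}{t_{k+1}}\left[(x_k,y_k)-(x_{k-1},y_{k-1})\right]$. 3. Option 1: $x_{k+1}=\mathbf{Prox}_{\alpha,f_1}\left(\bar x_k-\alpha\left(\nabla f_2(\bar x_k)+K^T\left(v_k+\frac{t_k}{t_{k+1}}(v_k-v_{k-1})\right)\right)\right)$ and $u_{k+1}=x_{k+1}+(t_{k+1}-1)(x_{k+1}-x_k)$. Option 2: $u_{k+1}=\mathbf{Prox}_{\alpha t_{k+1},f_1}\left(u_k-\alpha t_{k+1}\left(\nabla f_2(\bar x_k)+K^T\left(v_k+\frac{t_k}{t_{k+1}}(v_k-v_{k-1})\right)\right)\right)$ and $x_{k+1}=\frac{t_{k+1}-1}{t_{k+1}}x_k+\frac1{t_{k+1}}u_{k+1}$.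 4. $v_{k+1}=\mathbf{Prox}_{\beta/t_{k+1},\,g_1}\left(v_k-\frac{\beta}{t_{k+1}}\left(\nabla g_2(\bar y_k)-Ku_{k+1}\right)\right)$ and $y_{k+1}=\frac{t_{k+1}-1}{t_{k+1}}y_k+\frac1{t_{k+1}}v_{k+1}$. *)

theory Defs
  imports "HOL-Analysis.Analysis"
begin

text \<open>Functions into \<open>\<real> \<union> {+\<infinity>}\<close> are modelled as \<^typ>\<open>ereal\<close>-valued functions; the value
  \<open>-\<infinity>\<close> is excluded by \<open>proper_fun\<close>.\<close>

definition effdom :: "('a \<Rightarrow> ereal) \<Rightarrow> 'a set" where
  "effdom h = {x. h x < \<infinity>}"

definition proper_fun :: "('a \<Rightarrow> ereal) \<Rightarrow> bool" where
  "proper_fun h \<longleftrightarrow> (\<forall>x. h x \<noteq> -\<infinity>) \<and> effdom h \<noteq> {}"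

text \<open>Besides lower semicontinuity, closedness also asks for a closed effective domain.\<close>

definition closed_fun :: "('a::real_normed_vector \<Rightarrow> ereal) \<Rightarrow> bool" where
  "closed_fun h \<longleftrightarrow> (\<forall>x. h x \<le> Liminf (at x) h) \<and> closed (effdom h)"

text \<open>Only used for functions that never take the value \<open>-\<infinity>\<close>, so that the right-hand side
  contains no \<open>\<infinity> - \<infinity>\<close>; the convention \<open>0 * \<infinity> = 0\<close> of \<^typ>\<open>ereal\<close> makes \<open>s \<in> {0, 1}\<close> harmless.\<close>

definition convex_fun :: "('a::real_vector \<Rightarrow> ereal) \<Rightarrow> bool" where
  "convex_fun h \<longleftrightarrow>
     (\<forall>x y. \<forall>s\<in>{0..1}.
        h ((1 - s) *\<^sub>R x + s *\<^sub>R y) \<le> ereal (1 - s) * h x + ereal s * h y)"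

definition subdifferential :: "('a::real_inner \<Rightarrow> ereal) \<Rightarrow> 'a \<Rightarrow> 'a set" where
  "subdifferential h x =
     {w. x \<in> effdom h \<and> (\<forall>z. h z \<ge> h x + ereal (w \<bullet> (z - x)))}"

text \<open>Convexity is a separate conjunct: the subgradient inequality alone holds vacuously for
  every function without subgradients.\<close>

definition strongly_convex_fun :: "real \<Rightarrow> ('a::real_inner \<Rightarrow> ereal) \<Rightarrow> bool" where
  "strongly_convex_fun \<mu> h \<longleftrightarrow> convex_fun h \<and>
     (\<forall>y1 y2. \<forall>w \<in> subdifferential h y1.
        h y2 - h y1 - ereal (w \<bullet> (y2 - y1)) \<ge> ereal (\<mu> / 2 * (norm (y2 - y1))\<^sup>2))"

definition prox :: "real \<Rightarrow> ('a::real_normed_vector \<Rightarrow> ereal) \<Rightarrow> 'a \<Rightarrow> 'a" where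
  "prox \<gamma> h x = arg_min (\<lambda>y. h y + ereal (1 / (2 * \<gamma>) * (norm (y - x))\<^sup>2)) (\<lambda>_. True)"

text \<open>For \<open>x \<in> effdom f\<close> and \<open>y \<notin> effdom g\<close> this evaluates to \<open>-\<infinity>\<close>, and for \<open>x \<notin> effdom f\<close> and
  \<open>y \<in> effdom g\<close> to \<open>\<infinity>\<close>. The indeterminate case \<open>x \<notin> effdom f\<close>, \<open>y \<notin> effdom g\<close> never occurs in
  the notions below.\<close>

definition lagrangian ::
  "real^'n^'m \<Rightarrow> (real^'n \<Rightarrow> ereal) \<Rightarrow> (real^'m \<Rightarrow> ereal) \<Rightarrow> real^'n \<Rightarrow> real^'m \<Rightarrow> ereal" where
  "lagrangian K f g x y = f x + ereal ((K *v x) \<bullet> y) - g y"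

definition saddle_points ::
  "real^'n^'m \<Rightarrow> (real^'n \<Rightarrow> ereal) \<Rightarrow> (real^'m \<Rightarrow> ereal) \<Rightarrow> ((real^'n) \<times> (real^'m)) set" where
  "saddle_points K f g =
     {(x', y'). x' \<in> effdom f \<and> y' \<in> effdom g \<and>
        (\<forall>x y. lagrangian K f g x' y \<le> lagrangian K f g x' y' \<and>
               lagrangian K f g x' y' \<le> lagrangian K f g x y')}"

definition pd_gap :: "('a \<Rightarrow> 'b \<Rightarrow> ereal) \<Rightarrow> 'a set \<Rightarrow> 'b set \<Rightarrow> 'a \<Rightarrow> 'b \<Rightarrow> ereal" where
  "pd_gap L B1 B2 x y = (SUP y'\<in>B2. L x y') - (INF x'\<in>B1. L x' y)"

definition extrapolate ::
  "(nat \<Rightarrow> real) \<Rightarrow> (nat \<Rightarrow> 'a::real_vector) \<Rightarrow> nat \<Rightarrow> 'a" where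
  "extrapolate t z k = z k + ((t k - 1) / t (k + 1)) *\<^sub>R (z k - z (k - 1))"

definition dual_extrapolate ::
  "(nat \<Rightarrow> real) \<Rightarrow> (nat \<Rightarrow> 'a::real_vector) \<Rightarrow> nat \<Rightarrow> 'a" where
  "dual_extrapolate t v k = v k + (t k / t (k + 1)) *\<^sub>R (v k - v (k - 1))"

datatype x_update = Option1 | Option2

text \<open>\<open>Df2\<close> and \<open>Dg2\<close> stand for the gradients of the smooth parts.\<close>

fun x_step ::
  "x_update \<Rightarrow> real^'n^'m \<Rightarrow> (real^'n \<Rightarrow> ereal) \<Rightarrow> (real^'n \<Rightarrow> real^'n) \<Rightarrow> real \<Rightarrow>
   (nat \<Rightarrow> real) \<Rightarrow> (nat \<Rightarrow> real^'n) \<Rightarrow> (nat \<Rightarrow> real^'n) \<Rightarrow> (nat \<Rightarrow> real^'m) \<Rightarrow> nat \<Rightarrow> bool" where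
  "x_step Option1 K f1 Df2 \<alpha> t x u v k \<longleftrightarrow>
     x (k + 1) = prox \<alpha> f1 (extrapolate t x k
        - \<alpha> *\<^sub>R (Df2 (extrapolate t x k) + transpose K *v dual_extrapolate t v k)) \<and>
     u (k + 1) = x (k + 1) + (t (k + 1) - 1) *\<^sub>R (x (k + 1) - x k)"
| "x_step Option2 K f1 Df2 \<alpha> t x u v k \<longleftrightarrow>
     u (k + 1) = prox (\<alpha> * t (k + 1)) f1 (u k
        - (\<alpha> * t (k + 1)) *\<^sub>R (Df2 (extrapolate t x k) + transpose K *v dual_extrapolate t v k)) \<and>
     x (k + 1) = ((t (k + 1) - 1) / t (k + 1)) *\<^sub>R x k + (1 / t (k + 1)) *\<^sub>R u (k + 1)"

definition y_step ::
  "real^'n^'m \<Rightarrow> (real^'m \<Rightarrow> ereal) \<Rightarrow> (real^'m \<Rightarrow> real^'m) \<Rightarrow> real \<Rightarrow>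
   (nat \<Rightarrow> real) \<Rightarrow> (nat \<Rightarrow> real^'m) \<Rightarrow> (nat \<Rightarrow> real^'n) \<Rightarrow> (nat \<Rightarrow> real^'m) \<Rightarrow> nat \<Rightarrow> bool" where
  "y_step K g1 Dg2 \<beta> t y u v k \<longleftrightarrow>
     v (k + 1) = prox (\<beta> / t (k + 1)) g1 (v k
        - (\<beta> / t (k + 1)) *\<^sub>R (Dg2 (extrapolate t y k) - K *v u (k + 1))) \<and>
     y (k + 1) = ((t (k + 1) - 1) / t (k + 1)) *\<^sub>R y k + (1 / t (k + 1)) *\<^sub>R v (k + 1)"

text \<open>Initialisation uses index 0 (only for \<open>x\<close>, \<open>y\<close>, \<open>v\<close>) and index 1; the values
  \<open>t 0\<close> and \<open>u 0\<close> are irrelevant. As \<open>f\<close> and \<open>f1\<close> (and likewise \<open>g\<close> and \<open>g1\<close>) differ by a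
  finite-valued function, their effective domains agree.\<close>

definition inertial_pd_iterates ::
  "x_update \<Rightarrow> real^'n^'m \<Rightarrow> (real^'n \<Rightarrow> ereal) \<Rightarrow> (real^'n \<Rightarrow> real^'n) \<Rightarrow>
   (real^'m \<Rightarrow> ereal) \<Rightarrow> (real^'m \<Rightarrow> real^'m) \<Rightarrow> real \<Rightarrow> real \<Rightarrow> real \<Rightarrow>
   (nat \<Rightarrow> real) \<Rightarrow> (nat \<Rightarrow> real^'n) \<Rightarrow> (nat \<Rightarrow> real^'m) \<Rightarrow>
   (nat \<Rightarrow> real^'n) \<Rightarrow> (nat \<Rightarrow> real^'m) \<Rightarrow> bool" where
  "inertial_pd_iterates opt K f1 Df2 g1 Dg2 \<mu>g \<alpha> \<beta> t x y u v \<longleftrightarrow>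
     x 0 \<in> effdom f1 \<and> x 1 = x 0 \<and> u 1 = x 1 \<and>
     y 0 \<in> effdom g1 \<and> y 1 = y 0 \<and> v 0 = y 1 \<and> v 1 = v 0 \<and>
     (\<forall>k\<ge>1.
        t (k + 1) = min ((1 + sqrt (1 + 4 * (t k)\<^sup>2)) / 2) (sqrt ((t k)\<^sup>2 + \<mu>g * \<beta> * t k)) \<and>
        x_step opt K f1 Df2 \<alpha> t x u v k \<and>
        y_step K g1 Dg2 \<beta> t y u v k)"

end

theory Submission
  imports Defs
begin

text \<open>
  Write \<open>gap\<close> for \<open>L (x k) b - L a (y k)\<close>, with \<open>a\<close>, \<open>b\<close> arbitrary points of the two domains.
  The proof rests on an energy that dominates \<open>(t k)\<^sup>2 * gap\<close> and does not increase along
  the iteration.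

  Both options of the primal update, and the dual update, have the same shape: a proximal
  (implicit) step on the nonsmooth part, a gradient step at an extrapolated point, and an average
  \<open>t k *\<^sub>R x k = (t k - 1) *\<^sub>R x (k - 1) + u k\<close>. A subgradient inequality for the nonsmooth part, the tangent
  and descent inequalities for the smooth part and convexity along the average give
  (\<open>inertial_composite_step\<close>) a bound in which the objective is weighted by \<open>t\<^sup>2\<close> after
  the step and by \<open>t\<^sup>2 - t\<close> before it. Specialised to the two updates these are \<open>primal_step\<close>
  and \<open>dual_step\<close>. In the dual one strong convexity contributes \<open>t * \<mu>g / 2\<close> times a squared
  distance, which is exactly what allows the weight \<open>t\<^sup>2 / (2 * \<beta>)\<close> of that distance to be replaced
  by the larger weight of the next iteration; this is where the second term of the minimum
  in the recurrence of \<open>t\<close> comes from.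

  Adding the two bounds, the bilinear terms do not cancel, because the primal step sees the
  extrapolated \<open>v k + (t k / t (k + 1)) *\<^sub>R (v k - v (k - 1))\<close> and not \<open>v (k + 1)\<close>. What is left
  telescopes except for \<open>t k * (K (u (k + 1) - u k) \<bullet> (v k - v (k - 1)))\<close>. By Young's inequality
  this is absorbed, partly by the primal term \<open>norm (u (k + 1) - u k)\<close> of the current step,
  partly by the dual term \<open>norm (v k - v (k - 1))\<close> of the preceding one; the condition on
  \<open>\<alpha> * \<beta> * (onorm K)\<^sup>2\<close> says precisely that there is enough of both
  (\<open>coupling_bound\<close>, \<open>cross_weight_le\<close>). Hence \<open>energy_Suc_le\<close>: the energy grows at most by
  \<open>(t (k + 1))\<^sup>2 - t (k + 1) - (t k)\<^sup>2\<close> times the gap.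

  That factor is never positive, so at a saddle point, where the gap is nonnegative, the energy
  decreases, and all bounds relative to a saddle point are read off \<open>energy_lower_bound\<close>.
  If \<open>\<beta> * \<mu>g > 1 + 1 / t 1\<close>, the minimum in the recurrence is always attained by its first term and
  the factor vanishes; then the bound on the gap holds at every pair \<open>a\<close>, \<open>b\<close>, which gives the
  rate of the partial gap and, as \<open>k\<close> tends to infinity, shows that limit points are saddle points.

  All estimates are carried out with real-valued objectives on the effective domains, which
  the sequences \<open>x\<close> and \<open>y\<close> never leave. Extended values reappear only in the last part.
\<close>

section \<open>Closed convex functions and proximal points\<close>

lemma effdom_real_of_ereal:
  assumes "proper_fun h" "x \<in> effdom h"
  shows "ereal (real_of_ereal (h x)) = h x"
  using assms unfolding proper_fun_def effdom_def by (cases "h x") auto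

lemma not_in_effdom: "x \<notin> effdom h \<Longrightarrow> h x = \<infinity>"
  by (auto simp: effdom_def)

lemma effdom_add_ereal: "effdom (\<lambda>x. h x + ereal (q x)) = effdom h"
proof -
  have "h x + ereal (q x) < \<infinity> \<longleftrightarrow> h x < \<infinity>" for x by (cases "h x") auto
  then show ?thesis by (simp add: effdom_def)
qed

text \<open>Lower semicontinuity in topological form. It is stated for sums \<open>h + q\<close> because every function
  minimised below, the proximal objective and the partial Lagrangians, is of that form.\<close>
lemma open_superlevel_add_continuous:
  fixes h :: "'a::real_normed_vector \<Rightarrow> ereal"
  assumes h: "proper_fun h" "closed_fun h" and q: "continuous_on UNIV q"
  shows "open {x. c < h x + ereal (q x)}"
proof (subst open_subopen, intro ballI)
  fix a assume a: "a \<in> {x. c < h x + ereal (q x)}"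
  have nm: "h z \<noteq> -\<infinity>" for z using h(1) by (auto simp: proper_fun_def)
  have superlevel: "\<forall>\<^sub>F z in nhds a. r < h z" if "r < h a" for r
  proof -
    have "r < Liminf (at a) h"
      using that h(2) unfolding closed_fun_def by (meson less_le_trans)
    then have "\<forall>\<^sub>F z in at a. r < h z" by (rule less_LiminfD)
    then show ?thesis using that by (metis (mono_tags, lifting) eventually_nhds_conv_at)
  qed
  have "\<forall>\<^sub>F z in nhds a. c < h z + ereal (q z)"
  proof (cases c)
    case (real c')
    have "ereal (c' - q a) < h a" using a real by (cases "h a") auto
    then obtain r where r: "c' - q a < r" "ereal r < h a"
      using ereal_dense2[of "ereal (c' - q a)" "h a"] by auto
    have "isCont q a" using q by (simp add: continuous_on_eq_continuous_at)
    then have "\<forall>\<^sub>F z in nhds a. c' - r < q z"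
      using r(1) by (intro order_tendstoD(1)[of q "q a"])
        (auto simp: isCont_def tendsto_at_iff_tendsto_nhds)
    with superlevel[OF r(2)] show ?thesis
    proof eventually_elim
      case (elim z)
      then show ?case using real by (cases "h z") auto
    qed
  next
    case PInf
    then show ?thesis using a by auto
  next
    case MInf
    then show ?thesis using nm by (simp add: less_le)
  qed
  then show "\<exists>T. open T \<and> a \<in> T \<and> T \<subseteq> {x. c < h x + ereal (q x)}"
    unfolding eventually_nhds by blast
qed

text \<open>Weierstrass: if no point were minimal, the open sets \<open>{x. p b < p x}\<close> would cover \<open>S\<close>, and
  the least value over the centres of a finite subcover would itself be undercut.\<close>
lemma closed_fun_add_continuous_attains_inf:
  fixes h :: "'a::real_normed_vector \<Rightarrow> ereal"
  assumes h: "proper_fun h" "closed_fun h" and q: "continuous_on UNIV q"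
    and S: "compact S" "S \<noteq> {}"
  shows "\<exists>a\<in>S. \<forall>b\<in>S. h a + ereal (q a) \<le> h b + ereal (q b)"
proof (rule ccontr)
  let ?p = "\<lambda>x. h x + ereal (q x)"
  assume "\<not> ?thesis"
  then have cover: "S \<subseteq> (\<Union>b\<in>S. {x. ?p b < ?p x})" by (force simp: not_le)
  obtain C where C: "C \<subseteq> S" "finite C" "S \<subseteq> (\<Union>b\<in>C. {x. ?p b < ?p x})"
    by (rule compactE_image[OF S(1) _ cover]) (use open_superlevel_add_continuous[OF h q] in auto)
  then have "C \<noteq> {}" using S(2) by auto
  then obtain m where m: "m \<in> C" "\<forall>b\<in>C. ?p m \<le> ?p b"
    using arg_min_if_finite[OF C(2), of ?p] by (metis linorder_not_less)
  then obtain b where "b \<in> C" "?p b < ?p m" using C by blast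
  then show False using m by (meson not_le)
qed

lemma closed_fun_add_continuous_attains_inf_effdom:
  fixes h :: "'a::real_normed_vector \<Rightarrow> ereal"
  assumes h: "proper_fun h" "closed_fun h" and q: "continuous_on UNIV q"
    and S: "compact S" and a0: "a0 \<in> S" "a0 \<in> effdom h"
  shows "\<exists>a\<in>S \<inter> effdom h. \<forall>b\<in>S \<inter> effdom h.
    real_of_ereal (h a) + q a \<le> real_of_ereal (h b) + q b"
proof -
  obtain a where a: "a \<in> S" "\<And>b. b \<in> S \<Longrightarrow> h a + ereal (q a) \<le> h b + ereal (q b)"
    using closed_fun_add_continuous_attains_inf[OF h q S] a0(1) by blast
  have "a0 \<in> effdom (\<lambda>a. h a + ereal (q a))" using a0(2) by (simp add: effdom_add_ereal)
  then have "a \<in> effdom (\<lambda>a. h a + ereal (q a))"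
    using a(2)[OF a0(1)] by (auto simp: effdom_def)
  then have dom: "a \<in> effdom h" by (simp add: effdom_add_ereal)
  have "real_of_ereal (h a) + q a \<le> real_of_ereal (h b) + q b" if b: "b \<in> S \<inter> effdom h" for b
    using a(2)[of b] b effdom_real_of_ereal[OF h(1) dom] effdom_real_of_ereal[OF h(1), of b]
    by (metis IntD1 IntD2 ereal_less_eq(3) plus_ereal.simps(1))
  with a(1) dom show ?thesis by blast
qed

text \<open>The sequential form of lower semicontinuity, for real values; used to pass to the limit.\<close>
lemma closed_fun_eventually_above:
  fixes h :: "'a::real_normed_vector \<Rightarrow> ereal"
  assumes h: "proper_fun h" "closed_fun h" and z: "z \<longlonglongrightarrow> a" "\<And>i. z i \<in> effdom h"
    and a: "a \<in> effdom h" and e: "e > 0"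
  shows "\<forall>\<^sub>F i in sequentially. real_of_ereal (h a) - e < real_of_ereal (h (z i))"
proof -
  let ?U = "{x. ereal (real_of_ereal (h a) - e) < h x + ereal 0}"
  have "open ?U" by (rule open_superlevel_add_continuous[OF h]) auto
  moreover have "a \<in> ?U"
    using effdom_real_of_ereal[OF h(1) a] e
    by (metis (mono_tags, lifting) add.right_neutral diff_less_eq less_add_same_cancel1 less_ereal.simps(1) mem_Collect_eq zero_ereal_def)
  ultimately have "\<forall>\<^sub>F i in sequentially. z i \<in> ?U" using z(1) topological_tendstoD by blast
  then show ?thesis
  proof eventually_elim
    case (elim i)
    then show ?case using effdom_real_of_ereal[OF h(1) z(2), of i]
      by (metis (mono_tags, lifting) add.right_neutral less_ereal.simps(1) mem_Collect_eq zero_ereal_def)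
  qed
qed

lemma convex_fun_effdomD:
  assumes h: "proper_fun h" "convex_fun h" and xy: "x \<in> effdom h" "y \<in> effdom h" and s: "0 \<le> s" "s \<le> 1"
  shows "(1 - s) *\<^sub>R x + s *\<^sub>R y \<in> effdom h"
    and "real_of_ereal (h ((1 - s) *\<^sub>R x + s *\<^sub>R y))
      \<le> (1 - s) * real_of_ereal (h x) + s * real_of_ereal (h y)"
proof -
  let ?z = "(1 - s) *\<^sub>R x + s *\<^sub>R y"
  have "h ?z \<le> ereal (1 - s) * h x + ereal s * h y"
    using h(2) s unfolding convex_fun_def by auto
  also have "\<dots> = ereal ((1 - s) * real_of_ereal (h x) + s * real_of_ereal (h y))"
    using effdom_real_of_ereal[OF h(1) xy(1)] effdom_real_of_ereal[OF h(1) xy(2)]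
    by (metis plus_ereal.simps(1) times_ereal.simps(1))
  finally have *: "h ?z \<le> \<dots>" .
  then show z: "?z \<in> effdom h" unfolding effdom_def by (cases "h ?z") auto
  show "real_of_ereal (h ?z) \<le> (1 - s) * real_of_ereal (h x) + s * real_of_ereal (h y)"
    using * effdom_real_of_ereal[OF h(1) z] by (metis ereal_less_eq(3))
qed

lemma subdifferentialD:
  assumes h: "proper_fun h" and w: "w \<in> subdifferential h x" and z: "z \<in> effdom h"
  shows "real_of_ereal (h x) + w \<bullet> (z - x) \<le> real_of_ereal (h z)"
proof -
  have x: "x \<in> effdom h" using w by (simp add: subdifferential_def)
  have "h x + ereal (w \<bullet> (z - x)) \<le> h z" using w by (simp add: subdifferential_def)
  then show ?thesis
    using effdom_real_of_ereal[OF h x] effdom_real_of_ereal[OF h z]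
    by (metis ereal_less_eq(3) plus_ereal.simps(1))
qed

lemma strongly_convex_funD:
  assumes h: "proper_fun h" "strongly_convex_fun \<mu> h" and w: "w \<in> subdifferential h x"
    and z: "z \<in> effdom h"
  shows "real_of_ereal (h x) + w \<bullet> (z - x) + \<mu> / 2 * (norm (z - x))\<^sup>2 \<le> real_of_ereal (h z)"
proof -
  have x: "x \<in> effdom h" using w by (simp add: subdifferential_def)
  have "ereal (\<mu> / 2 * (norm (z - x))\<^sup>2) \<le> h z - h x - ereal (w \<bullet> (z - x))"
    using h w by (simp add: strongly_convex_fun_def)
  then have "ereal (\<mu> / 2 * (norm (z - x))\<^sup>2)
      \<le> ereal (real_of_ereal (h z)) - ereal (real_of_ereal (h x)) - ereal (w \<bullet> (z - x))"
    using effdom_real_of_ereal[OF h(1) x] effdom_real_of_ereal[OF h(1) z] by simp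
  then show ?thesis by simp
qed

text \<open>Fermat's rule with only one of the two summands smooth. Along the segment from \<open>p\<close> to \<open>z\<close>,
  convexity replaces \<open>h\<close> by its chord, so \<open>\<phi>\<close> plus a linear function of the parameter \<open>s\<close> is
  minimal at \<open>s = 0\<close> and its right derivative there cannot be negative.\<close>
lemma minimizer_subgradient:
  fixes h :: "'a::real_inner \<Rightarrow> ereal"
  assumes h: "proper_fun h" "convex_fun h" and p: "p \<in> effdom h"
    and min: "\<And>z. h p + ereal (\<phi> p) \<le> h z + ereal (\<phi> z)"
    and deriv: "GDERIV \<phi> p :> d"
  shows "- d \<in> subdifferential h p"
proof -
  have "h p + ereal (- d \<bullet> (z - p)) \<le> h z" for z
  proof (cases "z \<in> effdom h")
    case False
    then show ?thesis by (simp add: not_in_effdom)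
  next
    case z: True
    let ?H = "\<lambda>x. real_of_ereal (h x)"
    let ?\<psi> = "\<lambda>s. \<phi> (p + s *\<^sub>R (z - p)) - \<phi> p + s * (?H z - ?H p)"
    have nonneg: "0 \<le> ?\<psi> s" if s: "0 \<le> s" "s \<le> 1" for s
    proof -
      let ?w = "(1 - s) *\<^sub>R p + s *\<^sub>R z"
      have w: "?w = p + s *\<^sub>R (z - p)" by (simp add: algebra_simps)
      note cv = convex_fun_effdomD[OF h p z s]
      have "ereal (?H p + \<phi> p) \<le> ereal (?H ?w + \<phi> ?w)"
        using min[of ?w] effdom_real_of_ereal[OF h(1) p] effdom_real_of_ereal[OF h(1) cv(1)]
        by (metis plus_ereal.simps(1))
      with cv(2) show ?thesis unfolding w by (simp add: algebra_simps)
    qed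
    have "((\<lambda>s. \<phi> (p + s *\<^sub>R (z - p))) has_derivative (\<lambda>s. (s *\<^sub>R (z - p)) \<bullet> d)) (at 0)"
    proof (rule has_derivative_compose[where g = \<phi>])
      show "((\<lambda>s. p + s *\<^sub>R (z - p)) has_derivative (\<lambda>s. s *\<^sub>R (z - p))) (at 0)"
        by (auto intro!: derivative_eq_intros)
      show "(\<phi> has_derivative (\<lambda>h. h \<bullet> d)) (at (p + 0 *\<^sub>R (z - p)))"
        using deriv by (simp add: gderiv_def)
    qed
    then have "((\<lambda>s. \<phi> (p + s *\<^sub>R (z - p))) has_real_derivative (z - p) \<bullet> d) (at 0)"
      by (rule has_derivative_imp_has_field_derivative) (simp add: mult.commute)
    then have D: "(?\<psi> has_real_derivative (z - p) \<bullet> d + (?H z - ?H p)) (at 0)"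
      by (auto intro!: derivative_eq_intros)
    have "0 \<le> (z - p) \<bullet> d + (?H z - ?H p)"
    proof (rule ccontr)
      assume "\<not> ?thesis"
      then have "(z - p) \<bullet> d + (?H z - ?H p) < 0" by simp
      then obtain e where e: "e > 0" "\<forall>s>0. s < e \<longrightarrow> ?\<psi> (0 + s) < ?\<psi> 0"
        using DERIV_neg_dec_right[OF D] by auto
      define s where "s = min (e / 2) 1"
      have "0 < s" "s < e" "s \<le> 1" using e(1) by (auto simp: s_def min_def)
      then show False using e(2) nonneg[of s] by fastforce
    qed
    then have "?H p + - d \<bullet> (z - p) \<le> ?H z" by (simp add: inner_commute)
    then show ?thesis
      using effdom_real_of_ereal[OF h(1) p] effdom_real_of_ereal[OF h(1) z]
      by (metis ereal_less_eq(3) plus_ereal.simps(1))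
  qed
  with p show ?thesis by (simp add: subdifferential_def)
qed

text \<open>The proximal point is defined by choice, so a minimiser has to be shown to exist. A closed
  convex function decreases at most linearly: it is bounded below on a unit ball around a point
  of its domain, and convexity propagates this bound along rays. The quadratic
  term therefore wins outside a large ball, and inside it compactness applies.\<close>
lemma prox_minimizes:
  fixes h :: "'a::euclidean_space \<Rightarrow> ereal"
  assumes h: "proper_fun h" "closed_fun h" "convex_fun h" and \<gamma>: "\<gamma> > 0"
  shows "h (prox \<gamma> h x) + ereal (1 / (2 * \<gamma>) * (norm (prox \<gamma> h x - x))\<^sup>2)
    \<le> h z + ereal (1 / (2 * \<gamma>) * (norm (z - x))\<^sup>2)"
proof -
  let ?H = "\<lambda>x. real_of_ereal (h x)"
  let ?q = "\<lambda>y. 1 / (2 * \<gamma>) * (norm (y - x))\<^sup>2"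
  obtain a where a: "a \<in> effdom h" using h(1) by (auto simp: proper_fun_def)
  note fin = effdom_real_of_ereal[OF h(1)]
  obtain m where m: "m \<in> cball a 1" "\<forall>b\<in>cball a 1. h m + ereal 0 \<le> h b + ereal 0"
    using closed_fun_add_continuous_attains_inf[OF h(1,2), of "\<lambda>_. 0" "cball a 1"] by auto
  have "h m \<le> h a" using m(2) by simp
  then have mdom: "m \<in> effdom h" using a by (auto simp: effdom_def)
  define C where "C = ?H a - ?H m"
  have C: "0 \<le> C" using \<open>h m \<le> h a\<close> fin[OF a] fin[OF mdom] unfolding C_def
    by (metis diff_ge_0_iff_ge ereal_less_eq(3))
  have growth: "?H a - C * norm (b - a) \<le> ?H b" if b: "b \<in> effdom h" "norm (b - a) \<ge> 1" for b
  proof -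
    let ?r = "norm (b - a)"
    let ?w = "(1 - 1 / ?r) *\<^sub>R a + (1 / ?r) *\<^sub>R b"
    have rpos: "?r > 0" using b(2) by linarith
    then have r: "0 \<le> 1 / ?r" "1 / ?r \<le> 1" "?r > 0"
      using b(2) divide_le_eq_1_pos[OF rpos] by simp_all
    have "?w - a = (1 / ?r) *\<^sub>R (b - a)" by (simp add: algebra_simps)
    then have "norm (?w - a) = 1" using r(3) by (metis divide_self_if norm_scaleR abs_of_nonneg r(1) less_irrefl mult.left_neutral times_divide_eq_left)
    then have "?w \<in> cball a 1" by (metis dist_commute dist_norm mem_cball order_refl)
    then have "h m \<le> h ?w" using m(2) by (metis add.right_neutral zero_ereal_def)
    note cv = convex_fun_effdomD[OF h(1,3) a b(1) r(1,2)]
    have "?H m \<le> ?H ?w" using \<open>h m \<le> h ?w\<close> fin[OF mdom] fin[OF cv(1)] by (metis ereal_less_eq(3))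
    also have "\<dots> \<le> (1 - 1 / ?r) * ?H a + 1 / ?r * ?H b" by (rule cv(2))
    finally have "?r * ?H m \<le> ?r * ((1 - 1 / ?r) * ?H a + 1 / ?r * ?H b)"
      using r(3) by (simp add: mult_left_mono)
    also have "\<dots> = (?r - 1) * ?H a + ?H b" using r(3) by (simp add: field_simps)
    finally show ?thesis by (simp add: C_def algebra_simps)
  qed
  \<comment> \<open>For \<open>r \<ge> R\<close> and \<open>d = norm (a - x)\<close>: \<open>(r - d)\<^sup>2 - d\<^sup>2 = r * (r - 2 * d) \<ge> 2 * \<gamma> * C * r\<close>.\<close>
  define R where "R = max 1 (2 * norm (a - x) + 2 * \<gamma> * C)"
  have contq: "continuous_on UNIV ?q" by (intro continuous_intros)
  have aR: "a \<in> cball a R" by (simp add: R_def)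
  then have ne: "cball a R \<noteq> {}" by (metis empty_iff)
  obtain p where p: "p \<in> cball a R" "\<forall>b\<in>cball a R. h p + ereal (?q p) \<le> h b + ereal (?q b)"
    using closed_fun_add_continuous_attains_inf[OF h(1,2) contq compact_cball ne] by (elim bexE)
  have "h p + ereal (?q p) \<le> h b + ereal (?q b)" for b
  proof (cases "b \<in> cball a R")
    case True
    then show ?thesis using p(2) by blast
  next
    case False
    then have r: "norm (b - a) > R" by (simp add: dist_norm norm_minus_commute)
    then have r1: "norm (b - a) \<ge> 1" and r2: "norm (b - a) \<ge> 2 * norm (a - x) + 2 * \<gamma> * C"
      by (auto simp: R_def)
    show ?thesis
    proof (cases "b \<in> effdom h")
      case False
      then show ?thesis by (simp add: not_in_effdom)
    next
      case True
      let ?r = "norm (b - a)" and ?d = "norm (a - x)"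
      have "?r - ?d \<le> norm (b - x)"
        using norm_triangle_ineq4[of "b - x" "a - x"] by simp
      moreover have "0 \<le> ?r - ?d" using r2 C \<gamma> by (smt (verit) norm_ge_zero mult_nonneg_nonneg)
      ultimately have "(?r - ?d)\<^sup>2 \<le> (norm (b - x))\<^sup>2" by (simp add: power_mono)
      moreover have "?r * (2 * ?d + 2 * \<gamma> * C) \<le> ?r * ?r" using r2 by (simp add: mult_left_mono)
      ultimately have "2 * \<gamma> * (C * ?r) \<le> (norm (b - x))\<^sup>2 - ?d\<^sup>2"
        by (simp add: power2_eq_square algebra_simps)
      then have "C * ?r \<le> ((norm (b - x))\<^sup>2 - ?d\<^sup>2) / (2 * \<gamma>)" using \<gamma> by (simp add: field_simps)
      then have "?H a + ?q a \<le> ?H b + ?q b" using growth[OF True r1] by (simp add: diff_divide_distrib)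
      then have "h a + ereal (?q a) \<le> h b + ereal (?q b)"
        using fin[OF a] fin[OF True] by (metis ereal_less_eq(3) plus_ereal.simps(1))
      then show ?thesis using p(2) aR by (meson order_trans)
    qed
  qed
  then have "is_arg_min (\<lambda>y. h y + ereal (?q y)) (\<lambda>_. True) p"
    by (simp add: is_arg_min_def not_less)
  then have "is_arg_min (\<lambda>y. h y + ereal (?q y)) (\<lambda>_. True) (prox \<gamma> h x)"
    unfolding prox_def arg_min_def by (rule someI)
  then show ?thesis by (simp add: is_arg_min_def not_less)
qed

lemma gderiv_half_sqnorm:
  fixes x p :: "'a::real_inner"
  shows "GDERIV (\<lambda>y. c / 2 * (norm (y - x))\<^sup>2) p :> c *\<^sub>R (p - x)"
  unfolding gderiv_def power2_norm_eq_inner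
  by (auto intro!: derivative_eq_intros simp: inner_commute inner_simps algebra_simps)

lemma prox_subgradient:
  fixes h :: "'a::euclidean_space \<Rightarrow> ereal"
  assumes h: "proper_fun h" "closed_fun h" "convex_fun h" and \<gamma>: "\<gamma> > 0"
  shows "(1 / \<gamma>) *\<^sub>R (x - prox \<gamma> h x) \<in> subdifferential h (prox \<gamma> h x)"
proof -
  let ?p = "prox \<gamma> h x"
  let ?q = "\<lambda>y. 1 / (2 * \<gamma>) * (norm (y - x))\<^sup>2"
  have min: "h ?p + ereal (?q ?p) \<le> h z + ereal (?q z)" for z by (rule prox_minimizes[OF h \<gamma>])
  obtain a where a: "a \<in> effdom h" using h(1) by (auto simp: proper_fun_def)
  then have "h a + ereal (?q a) < \<infinity>" by (auto simp: effdom_def)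
  with min[of a] have "h ?p + ereal (?q ?p) < \<infinity>" by (rule le_less_trans)
  then have p: "?p \<in> effdom h" by (cases "h ?p") (auto simp: effdom_def)
  have "GDERIV ?q ?p :> (1 / \<gamma>) *\<^sub>R (?p - x)"
    using gderiv_half_sqnorm[of "1 / \<gamma>" x ?p] by (simp add: divide_divide_eq_left mult.commute)
  from minimizer_subgradient[where \<phi> = ?q, OF h(1,3) p min this] show ?thesis
    by (metis minus_diff_eq scaleR_minus_right)
qed

text \<open>A special case of Fermat's rule: every point minimises \<open>f + (- f)\<close>.\<close>
lemma convex_above_tangent:
  fixes f :: "'a::real_inner \<Rightarrow> real"
  assumes "convex_on UNIV f" "GDERIV f x :> d"
  shows "f x + d \<bullet> (z - x) \<le> f z"
proof -
  have "convex_fun (\<lambda>x. ereal (f x))"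
    using assms(1) unfolding convex_fun_def by (auto simp: convex_on_def)
  moreover have "proper_fun (\<lambda>x. ereal (f x))" by (simp add: proper_fun_def effdom_def)
  moreover have "GDERIV (\<lambda>x. - f x) x :> - d"
    using assms(2) by (rule GDERIV_minus)
  ultimately have "- (- d) \<in> subdifferential (\<lambda>x. ereal (f x)) x"
    by (intro minimizer_subgradient[where \<phi> = "\<lambda>x. - f x"]) (auto simp: effdom_def)
  then show ?thesis by (simp add: subdifferential_def)
qed

text \<open>The descent lemma: along the segment the derivative of the difference of both sides is
  nonpositive, by Cauchy--Schwarz and the Lipschitz bound.\<close>
lemma lipschitz_gradient_upper_bound:
  fixes f :: "'a::real_inner \<Rightarrow> real"
  assumes D: "\<And>x. GDERIV f x :> Df x" and L: "L-lipschitz_on UNIV Df"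
  shows "f z \<le> f x + Df x \<bullet> (z - x) + L / 2 * (norm (z - x))\<^sup>2"
proof -
  let ?d = "z - x"
  let ?\<psi> = "\<lambda>s. f (x + s *\<^sub>R ?d) - s * (Df x \<bullet> ?d) - L / 2 * s\<^sup>2 * (norm ?d)\<^sup>2"
  have "?\<psi> 1 \<le> ?\<psi> 0"
  proof (rule DERIV_nonpos_imp_nonincreasing[where f = ?\<psi>])
    fix s :: real assume s: "0 \<le> s" "s \<le> 1"
    have "((\<lambda>s. f (x + s *\<^sub>R ?d)) has_derivative (\<lambda>r. (r *\<^sub>R ?d) \<bullet> Df (x + s *\<^sub>R ?d))) (at s)"
    proof (rule has_derivative_compose[where g = f])
      show "((\<lambda>s. x + s *\<^sub>R ?d) has_derivative (\<lambda>s. s *\<^sub>R ?d)) (at s)"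
        by (auto intro!: derivative_eq_intros)
      show "(f has_derivative (\<lambda>h. h \<bullet> Df (x + s *\<^sub>R ?d))) (at (x + s *\<^sub>R ?d))"
        using D by (simp add: gderiv_def)
    qed
    then have "((\<lambda>s. f (x + s *\<^sub>R ?d)) has_real_derivative ?d \<bullet> Df (x + s *\<^sub>R ?d)) (at s)"
      by (rule has_derivative_imp_has_field_derivative) (simp add: mult.commute)
    then have "(?\<psi> has_real_derivative
        ?d \<bullet> Df (x + s *\<^sub>R ?d) - Df x \<bullet> ?d - L * s * (norm ?d)\<^sup>2) (at s)"
      by (auto intro!: derivative_eq_intros)
    moreover have "?d \<bullet> Df (x + s *\<^sub>R ?d) - Df x \<bullet> ?d - L * s * (norm ?d)\<^sup>2 \<le> 0"
    proof -
      have "?d \<bullet> Df (x + s *\<^sub>R ?d) - Df x \<bullet> ?d = (Df (x + s *\<^sub>R ?d) - Df x) \<bullet> ?d"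
        by (simp add: inner_diff_left inner_diff_right inner_commute)
      also have "\<dots> \<le> norm (Df (x + s *\<^sub>R ?d) - Df x) * norm ?d" by (rule norm_cauchy_schwarz)
      also have "norm (Df (x + s *\<^sub>R ?d) - Df x) \<le> L * norm (s *\<^sub>R ?d)"
        using lipschitz_onD[OF L, of "x + s *\<^sub>R ?d" x] by (simp add: dist_norm)
      then have "norm (Df (x + s *\<^sub>R ?d) - Df x) * norm ?d \<le> L * norm (s *\<^sub>R ?d) * norm ?d"
        by (rule mult_right_mono) simp
      also have "L * norm (s *\<^sub>R ?d) * norm ?d = L * s * (norm ?d)\<^sup>2"
        using s by (simp add: power2_eq_square)
      finally show ?thesis by simp
    qed
    ultimately show "\<exists>y. (?\<psi> has_real_derivative y) (at s) \<and> y \<le> 0" by blast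
  qed simp
  then show ?thesis by (simp add: algebra_simps)
qed

section \<open>One inertial proximal step\<close>

text \<open>The updates of \<open>x\<close> and \<open>y\<close> are averages of the form \<open>T *\<^sub>R z' = (T - 1) *\<^sub>R z + p\<close>; this
  division-free form is the one that survives multiplication by the weights \<open>T\<close> and \<open>T\<^sup>2\<close>.\<close>
lemma weighted_average:
  fixes z z' p :: "'a::real_vector"
  assumes "T \<ge> 1" "T *\<^sub>R z' = (T - 1) *\<^sub>R z + p"
  shows "z' = (1 - 1 / T) *\<^sub>R z + (1 / T) *\<^sub>R p"
proof -
  have "(1 / T) *\<^sub>R (T *\<^sub>R z') = (1 / T) *\<^sub>R ((T - 1) *\<^sub>R z + p)" using assms(2) by simp
  then show ?thesis using assms(1) by (simp add: scaleR_add_right diff_divide_distrib)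
qed

lemma avg_mem_convex:
  assumes "convex C" "T \<ge> 1" "T *\<^sub>R z' = (T - 1) *\<^sub>R z + p" "z \<in> C" "p \<in> C"
  shows "z' \<in> C"
  using weighted_average[OF assms(2,3)] assms by (auto intro: convexD)

lemma avg_in_effdom:
  assumes h: "proper_fun h" "convex_fun h" and T: "T \<ge> 1"
    and z': "T *\<^sub>R z' = (T - 1) *\<^sub>R z + p" and dom: "z \<in> effdom h" "p \<in> effdom h"
  shows "z' \<in> effdom h"
    and "T * real_of_ereal (h z') \<le> (T - 1) * real_of_ereal (h z) + real_of_ereal (h p)"
proof -
  note eq = weighted_average[OF T z']
  have s: "0 \<le> 1 / T" "1 / T \<le> 1" using T by auto
  note cv = convex_fun_effdomD[OF h dom s]
  show "z' \<in> effdom h" using cv(1) eq by simp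
  have "T * real_of_ereal (h z') \<le> T * ((1 - 1 / T) * real_of_ereal (h z) + 1 / T * real_of_ereal (h p))"
    using cv(2) T by (intro mult_left_mono) (auto simp: eq)
  also have "\<dots> = (T - 1) * real_of_ereal (h z) + real_of_ereal (h p)"
    using T by (simp add: distrib_left diff_divide_distrib left_diff_distrib right_diff_distrib)
  finally show "T * real_of_ereal (h z') \<le> (T - 1) * real_of_ereal (h z) + real_of_ereal (h p)" .
qed

lemma inner_diff_polarization:
  fixes p q a :: "'a::real_inner"
  shows "(p - q) \<bullet> (p - a) = ((norm (p - q))\<^sup>2 + (norm (p - a))\<^sup>2 - (norm (q - a))\<^sup>2) / 2"
  by (simp add: power2_norm_eq_inner inner_simps inner_commute)

text \<open>The common core of the primal and the dual update. Here \<open>z'\<close> and \<open>zb\<close> are averages of the same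
  point \<open>z\<close> with \<open>p'\<close> and \<open>p\<close>, so that \<open>T *\<^sub>R (z' - zb) = p' - p\<close>: this is the identity which makes
  the error of the gradient step, after multiplication by \<open>T\<^sup>2\<close>, independent of \<open>T\<close>. The
  last assumption is what a subgradient inequality for \<open>h1\<close> yields, whether the subgradient is
  taken at \<open>z'\<close> or at \<open>p'\<close>.\<close>
lemma inertial_composite_step:
  fixes h1 h2 :: "'a::real_inner \<Rightarrow> real"
  assumes T: "T \<ge> 1"
    and z': "T *\<^sub>R z' = (T - 1) *\<^sub>R z + p'" and zb: "T *\<^sub>R zb = (T - 1) *\<^sub>R z + p"
    and h2: "convex_on UNIV h2" "\<And>a. GDERIV h2 a :> Dh a" "L-lipschitz_on UNIV Dh"
    and h1: "T * h1 z' \<le> (T - 1) * h1 z + h1 a + \<xi> \<bullet> (p' - a) - \<mu> / 2 * (norm (p' - a))\<^sup>2"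
  shows "T\<^sup>2 * (h1 z' + h2 z' - (h1 a + h2 a))
    \<le> (T\<^sup>2 - T) * (h1 z + h2 z - (h1 a + h2 a)) + T * ((\<xi> + Dh zb) \<bullet> (p' - a))
      - T * \<mu> / 2 * (norm (p' - a))\<^sup>2 + L / 2 * (norm (p' - p))\<^sup>2"
proof -
  have diff: "T *\<^sub>R (z' - zb) = p' - p" unfolding scaleR_diff_right z' zb by simp
  have "T * norm (z' - zb) = norm (p' - p)"
    using T unfolding diff[symmetric] by simp
  then have nrm: "T\<^sup>2 * (norm (z' - zb))\<^sup>2 = (norm (p' - p))\<^sup>2" by (metis power_mult_distrib)
  have up: "h2 z' \<le> h2 zb + Dh zb \<bullet> (z' - zb) + L / 2 * (norm (z' - zb))\<^sup>2"
    by (rule lipschitz_gradient_upper_bound[OF h2(2,3)])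
  have lo: "h2 zb + Dh zb \<bullet> (w - zb) \<le> h2 w" for w
    by (rule convex_above_tangent[OF h2(1,2)])
  have "T\<^sup>2 * h2 z' \<le> T\<^sup>2 * (h2 zb + Dh zb \<bullet> (z' - zb) + L / 2 * (norm (z' - zb))\<^sup>2)"
    using up by (rule mult_left_mono) simp
  also have "\<dots> = T * (T * h2 zb + Dh zb \<bullet> (T *\<^sub>R (z' - zb))) + L / 2 * (norm (p' - p))\<^sup>2"
    unfolding nrm[symmetric] by (simp add: algebra_simps power2_eq_square)
  also have "T * h2 zb + Dh zb \<bullet> (T *\<^sub>R (z' - zb))
      = (T - 1) * (h2 zb + Dh zb \<bullet> (z - zb)) + (h2 zb + Dh zb \<bullet> (a - zb)) + Dh zb \<bullet> (p' - a)"
  proof -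
    have "T *\<^sub>R (z' - zb) = (T - 1) *\<^sub>R (z - zb) + (a - zb) + (p' - a)"
      unfolding scaleR_diff_right z' by (simp add: algebra_simps)
    then show ?thesis by (simp add: inner_add_right) (simp add: algebra_simps)
  qed
  also have "T * \<dots> + L / 2 * (norm (p' - p))\<^sup>2
      \<le> T * ((T - 1) * h2 z + h2 a + Dh zb \<bullet> (p' - a)) + L / 2 * (norm (p' - p))\<^sup>2"
    using T lo[of z] lo[of a] by (intro add_right_mono mult_left_mono add_mono) auto
  finally have smooth: "T\<^sup>2 * h2 z' \<le> \<dots>" .
  have "T * (T * h1 z') \<le> T * ((T - 1) * h1 z + h1 a + \<xi> \<bullet> (p' - a) - \<mu> / 2 * (norm (p' - a))\<^sup>2)"
    using h1 T by (intro mult_left_mono) auto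
  with smooth show ?thesis
    by (simp add: power2_eq_square algebra_simps inner_add_left)
qed

text \<open>Young's inequality, from \<open>(2 * \<rho> * a - \<kappa> * \<bar>s\<bar> * b)\<^sup>2 \<ge> 0\<close>.\<close>
lemma cross_term_young:
  fixes \<rho> :: real
  assumes "\<rho> > 0" "\<bar>q\<bar> \<le> \<kappa> * a * b"
  shows "\<bar>s * q\<bar> \<le> \<rho> * a\<^sup>2 + \<kappa>\<^sup>2 / (4 * \<rho>) * (s\<^sup>2 * b\<^sup>2)"
proof -
  have "\<bar>s * q\<bar> = \<bar>s\<bar> * \<bar>q\<bar>" by (simp add: abs_mult)
  also have "\<dots> \<le> \<bar>s\<bar> * (\<kappa> * a * b)" using assms(2) by (simp add: mult_left_mono)
  also have "\<dots> \<le> \<rho> * a\<^sup>2 + \<kappa>\<^sup>2 / (4 * \<rho>) * (s\<^sup>2 * b\<^sup>2)"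
  proof -
    have "0 \<le> (2 * \<rho> * a - \<kappa> * \<bar>s\<bar> * b)\<^sup>2 / (4 * \<rho>)" using assms(1) by simp
    also have "(2 * \<rho> * a - \<kappa> * \<bar>s\<bar> * b)\<^sup>2
        = 4 * \<rho> * (\<rho> * a\<^sup>2 - \<bar>s\<bar> * (\<kappa> * a * b)) + \<kappa>\<^sup>2 * (s\<^sup>2 * b\<^sup>2)"
      unfolding power2_abs[of s, symmetric] by (simp add: power2_eq_square algebra_simps)
    also have "\<dots> / (4 * \<rho>) = \<rho> * a\<^sup>2 + \<kappa>\<^sup>2 / (4 * \<rho>) * (s\<^sup>2 * b\<^sup>2) - \<bar>s\<bar> * (\<kappa> * a * b)"
      using assms(1) by (simp add: add_divide_distrib)
    finally show ?thesis by simp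
  qed
  finally show ?thesis .
qed

lemma norm_le_of_rate:
  assumes "c > 0" "c * s\<^sup>2 * r\<^sup>2 \<le> e" "s > 0"
  shows "r \<le> sqrt (e / c) / (s::real)"
proof -
  have "(s * r)\<^sup>2 \<le> e / c" using assms by (simp add: pos_le_divide_eq power_mult_distrib mult_ac)
  then have "s * r \<le> sqrt (e / c)" by (rule real_le_rsqrt)
  then show ?thesis using assms(3) by (simp add: pos_le_divide_eq mult.commute)
qed

section \<open>Iterates and their one-step inequalities\<close>

text \<open>The data and hypotheses of a run of the algorithm. Saddle points enter only later, since
  the basic energy estimate holds at every pair of points of the domains.\<close>
locale inertial_primal_dual =
  fixes K :: "real^'n^'m"
    and f1 :: "real^'n \<Rightarrow> ereal" and f2 :: "real^'n \<Rightarrow> real" and Df2 :: "real^'n \<Rightarrow> real^'n"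
    and g1 :: "real^'m \<Rightarrow> ereal" and g2 :: "real^'m \<Rightarrow> real" and Dg2 :: "real^'m \<Rightarrow> real^'m"
    and Lf2 Lg2 \<mu>g \<alpha> \<beta> :: real
    and opt :: x_update
    and t :: "nat \<Rightarrow> real"
    and x u :: "nat \<Rightarrow> real^'n" and y v :: "nat \<Rightarrow> real^'m"
  assumes f1: "proper_fun f1" "closed_fun f1" "convex_fun f1"
    and g1: "proper_fun g1" "closed_fun g1" "strongly_convex_fun \<mu>g g1" "\<mu>g > 0"
    and f2: "convex_on UNIV f2" "\<And>a. GDERIV f2 a :> Df2 a" "Lf2-lipschitz_on UNIV Df2" "Lf2 > 0"
    and g2: "convex_on UNIV g2" "\<And>b. GDERIV g2 b :> Dg2 b" "Lg2-lipschitz_on UNIV Dg2" "Lg2 > 0"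
    and params: "\<alpha> > 0" "\<beta> > 0" "t 1 \<ge> 1"
      "\<alpha> * \<beta> * (onorm ((*v) K))\<^sup>2 < (1 - \<alpha> * Lf2) * (1 - \<beta> * Lg2 / (t 1)\<^sup>2)"
      "\<alpha> < 1 / Lf2"
    and iterates: "inertial_pd_iterates opt K f1 Df2 g1 Dg2 \<mu>g \<alpha> \<beta> t x y u v"
begin

definition F :: "real^'n \<Rightarrow> real" where "F a = real_of_ereal (f1 a) + f2 a"
definition G :: "real^'m \<Rightarrow> real" where "G b = real_of_ereal (g1 b) + g2 b"
definition Lag :: "real^'n \<Rightarrow> real^'m \<Rightarrow> real" where "Lag a b = F a + (K *v a) \<bullet> b - G b"
definition gap :: "real^'n \<Rightarrow> real^'m \<Rightarrow> nat \<Rightarrow> real" where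
  "gap a b k = Lag (x k) b - Lag a (y k)"

lemma g1_convex: "convex_fun g1" using g1(3) by (simp add: strongly_convex_fun_def)

lemma init: "x 0 \<in> effdom f1" "x 1 = x 0" "u 1 = x 1" "y 0 \<in> effdom g1" "y 1 = y 0" "v 0 = y 1" "v 1 = v 0"
  using iterates by (simp_all add: inertial_pd_iterates_def)

lemma steps:
  assumes "k \<ge> 1"
  shows "t (Suc k) = min ((1 + sqrt (1 + 4 * (t k)\<^sup>2)) / 2) (sqrt ((t k)\<^sup>2 + \<mu>g * \<beta> * t k))"
    "x_step opt K f1 Df2 \<alpha> t x u v k" "y_step K g1 Dg2 \<beta> t y u v k"
  using iterates assms by (simp_all add: inertial_pd_iterates_def)

text \<open>The first entry of the minimum is the positive root \<open>A\<close> of \<open>A\<^sup>2 - A = (t k)\<^sup>2\<close>, the second has square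
  \<open>(t k)\<^sup>2 + \<mu>g * \<beta> * t k\<close>. The first is the smaller one if \<open>A \<le> \<mu>g * \<beta> * t k\<close>, which holds for large
  \<open>\<beta> * \<mu>g\<close> since \<open>A \<le> t k + 1\<close>.\<close>
lemma stepsize_recurrence:
  assumes "k \<ge> 1" "t k \<ge> 1"
  shows "t k \<le> t (Suc k)" "t (Suc k) \<le> t k + 1" "(t (Suc k))\<^sup>2 - t (Suc k) \<le> (t k)\<^sup>2"
    "(t (Suc k))\<^sup>2 \<le> (t k)\<^sup>2 + \<mu>g * \<beta> * t k"
    "\<beta> * \<mu>g > 1 + 1 / t k \<Longrightarrow> (t (Suc k))\<^sup>2 - t (Suc k) = (t k)\<^sup>2"
proof -
  define A where "A = (1 + sqrt (1 + 4 * (t k)\<^sup>2)) / 2"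
  define B where "B = sqrt ((t k)\<^sup>2 + \<mu>g * \<beta> * t k)"
  have T: "t (Suc k) = min A B" using steps(1)[OF assms(1)] by (simp add: A_def B_def)
  have pos: "0 \<le> \<mu>g * \<beta> * t k" using assms(2) g1(4) params(2) by simp
  have "(sqrt (1 + 4 * (t k)\<^sup>2))\<^sup>2 = 1 + 4 * (t k)\<^sup>2" by (simp add: add_nonneg_nonneg)
  then have A2: "A\<^sup>2 - A = (t k)\<^sup>2" unfolding A_def by (simp add: power2_eq_square field_simps)
  have B2: "B\<^sup>2 = (t k)\<^sup>2 + \<mu>g * \<beta> * t k" using pos by (simp add: B_def)
  have "sqrt ((2 * t k)\<^sup>2) \<le> sqrt (1 + 4 * (t k)\<^sup>2)" by (intro real_sqrt_le_mono) (simp add: power_mult_distrib)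
  then have tA: "t k \<le> A" using assms(2) unfolding A_def real_sqrt_abs by simp
  have "sqrt (1 + 4 * (t k)\<^sup>2) \<le> sqrt ((1 + 2 * t k)\<^sup>2)"
    using assms(2) by (intro real_sqrt_le_mono) (simp add: power2_eq_square algebra_simps)
  then have At: "A \<le> t k + 1" using assms(2) unfolding A_def real_sqrt_abs by simp
  have "sqrt ((t k)\<^sup>2) \<le> B" unfolding B_def by (intro real_sqrt_le_mono) (use pos in simp)
  then have tB: "t k \<le> B" using assms(2) by simp
  show mono: "t k \<le> t (Suc k)" using T tA tB by simp
  show "t (Suc k) \<le> t k + 1" using T At by simp
  have "t (Suc k) * (t (Suc k) - 1) \<le> A * (A - 1)"
    using T mono assms(2) by (intro mult_mono) auto
  then show "(t (Suc k))\<^sup>2 - t (Suc k) \<le> (t k)\<^sup>2" using A2 by (simp add: power2_eq_square algebra_simps)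
  have "(t (Suc k))\<^sup>2 \<le> B\<^sup>2" using T mono assms(2) by (intro power_mono) auto
  then show "(t (Suc k))\<^sup>2 \<le> (t k)\<^sup>2 + \<mu>g * \<beta> * t k" using B2 by simp
  show "(t (Suc k))\<^sup>2 - t (Suc k) = (t k)\<^sup>2" if "\<beta> * \<mu>g > 1 + 1 / t k"
  proof -
    have "(1 + 1 / t k) * t k \<le> \<beta> * \<mu>g * t k" using that assms(2) by (intro mult_right_mono) auto
    then have "t k + 1 \<le> \<beta> * \<mu>g * t k" using assms(2) by (simp add: distrib_right)
    then have "A\<^sup>2 \<le> B\<^sup>2" using A2 B2 At by (simp add: mult.commute)
    then have "A \<le> B" by (rule power2_le_imp_le) (use tB assms(2) in simp)
    then show ?thesis using A2 T by simp
  qed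
qed

lemma t_ge_t1: "k \<ge> 1 \<Longrightarrow> t 1 \<le> t k"
proof (induction k rule: nat_induct_at_least)
  case (Suc k)
  then show ?case using stepsize_recurrence(1)[of k] params(3) by simp
qed simp

lemma t_ge_1: "k \<ge> 1 \<Longrightarrow> 1 \<le> t k" using t_ge_t1 params(3) by fastforce

lemmas t_mono = stepsize_recurrence(1)[OF _ t_ge_1]
lemmas t_Suc_le = stepsize_recurrence(2)[OF _ t_ge_1]
lemmas t_Suc_square_le = stepsize_recurrence(3)[OF _ t_ge_1]
lemmas t_Suc_square_le_mu = stepsize_recurrence(4)[OF _ t_ge_1]

lemma t_Suc_square_eq:
  assumes "\<beta> * \<mu>g > 1 + 1 / t 1" "k \<ge> 1"
  shows "(t (Suc k))\<^sup>2 - t (Suc k) = (t k)\<^sup>2"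
proof -
  have "1 / t k \<le> 1 / t 1" using t_ge_t1[OF assms(2)] params(3) by (intro divide_left_mono) auto
  then show ?thesis using assms stepsize_recurrence(5)[OF assms(2) t_ge_1] by simp
qed

text \<open>Under Option 2 this is the definition of \<open>x\<close>, under Option 1 that of \<open>u\<close>. For \<open>k = 1\<close> it holds by
  the choice of the initial points.\<close>
lemma x_avg:
  assumes "k \<ge> 1"
  shows "t k *\<^sub>R x k = (t k - 1) *\<^sub>R x (k - 1) + u k"
proof (cases "k = 1")
  case True
  then show ?thesis using init(2,3) by (simp add: algebra_simps)
next
  case False
  then obtain j where k: "k = Suc j" "j \<ge> 1" using assms by (cases k) auto
  have T: "t k > 0" using t_ge_1[OF assms] by simp
  show ?thesis
  proof (cases opt)
    case Option1
    then show ?thesis using steps(2)[OF k(2)] k(1) by (simp add: algebra_simps)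
  next
    case Option2
    then have "x k = ((t k - 1) / t k) *\<^sub>R x j + (1 / t k) *\<^sub>R u k"
      using steps(2)[OF k(2)] k(1) by simp
    then show ?thesis using T k(1) by (simp add: scaleR_add_right)
  qed
qed

lemma y_avg:
  assumes "k \<ge> 1"
  shows "t k *\<^sub>R y k = (t k - 1) *\<^sub>R y (k - 1) + v k"
proof (cases "k = 1")
  case True
  then show ?thesis using init(5-7) by (simp add: algebra_simps)
next
  case False
  then obtain j where k: "k = Suc j" "j \<ge> 1" using assms by (cases k) auto
  have T: "t k > 0" using t_ge_1[OF assms] by simp
  have "y k = ((t k - 1) / t k) *\<^sub>R y j + (1 / t k) *\<^sub>R v k"
    using steps(3)[OF k(2)] k(1) by (simp add: y_step_def)
  then show ?thesis using T k(1) by (simp add: scaleR_add_right)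
qed

text \<open>The extrapolated point is an average with the \<^emph>\<open>next\<close> weight \<open>t (Suc k)\<close> but the
  \<^emph>\<open>current\<close> auxiliary point.\<close>
lemma extrapolate_avg:
  assumes "k \<ge> 1" and avg: "t k *\<^sub>R z k = (t k - 1) *\<^sub>R z (k - 1) + w"
  shows "t (Suc k) *\<^sub>R extrapolate t z k = (t (Suc k) - 1) *\<^sub>R z k + w"
proof -
  have "t (Suc k) > 0" using t_ge_1[of "Suc k"] by simp
  then have "t (Suc k) *\<^sub>R extrapolate t z k = t (Suc k) *\<^sub>R z k + (t k - 1) *\<^sub>R (z k - z (k - 1))"
    by (simp add: extrapolate_def scaleR_add_right)
  then show ?thesis using avg by (simp add: algebra_simps)
qed

lemma y_v_effdom: "y k \<in> effdom g1 \<and> v k \<in> effdom g1"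
proof (induction k)
  case 0
  then show ?case using init by simp
next
  case (Suc k)
  show ?case
  proof (cases "k = 0")
    case True
    then show ?thesis using init by simp
  next
    case False
    then have k: "k \<ge> 1" by simp
    have "\<beta> / t (Suc k) > 0" using params(2) t_ge_1[of "Suc k"] by simp
    from prox_subgradient[OF g1(1,2) g1_convex this]
    have v: "v (Suc k) \<in> effdom g1" using steps(3)[OF k] by (auto simp: y_step_def subdifferential_def)
    with avg_in_effdom(1)[OF g1(1) g1_convex t_ge_1 y_avg[of "Suc k"]] Suc show ?thesis by simp
  qed
qed

text \<open>Both options produce this vector as a subgradient of \<open>f1\<close>, at \<open>x (Suc k)\<close> for Option 1 and at
  \<open>u (Suc k)\<close> for Option 2; the analysis does not distinguish them after \<open>x_step_inequality\<close>.\<close>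
definition \<xi> :: "nat \<Rightarrow> real^'n" where
  "\<xi> k = - (1 / (\<alpha> * t (Suc k))) *\<^sub>R (u (Suc k) - u k)
     - (Df2 (extrapolate t x k) + transpose K *v dual_extrapolate t v k)"

lemma x_step_subgradient:
  assumes k: "k \<ge> 1"
  shows "\<xi> k \<in> subdifferential f1 (case opt of Option1 \<Rightarrow> x (Suc k) | Option2 \<Rightarrow> u (Suc k))"
proof -
  let ?T = "t (Suc k)" and ?xb = "extrapolate t x k"
  let ?d = "Df2 ?xb + transpose K *v dual_extrapolate t v k"
  have T: "?T > 0" using t_ge_1[of "Suc k"] by simp
  show ?thesis
  proof (cases opt)
    case Option1
    have "?T *\<^sub>R (x (Suc k) - ?xb) = u (Suc k) - u k"
      using x_avg[of "Suc k"] extrapolate_avg[OF k x_avg[OF k]] unfolding scaleR_diff_right by simp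
    then have "(1 / (\<alpha> * ?T)) *\<^sub>R (u (Suc k) - u k) = (1 / (\<alpha> * ?T)) *\<^sub>R (?T *\<^sub>R (x (Suc k) - ?xb))" by simp
    also have "\<dots> = (1 / \<alpha>) *\<^sub>R (x (Suc k) - ?xb)" using T by simp
    finally have *: "(1 / \<alpha>) *\<^sub>R ((?xb - \<alpha> *\<^sub>R ?d) - x (Suc k)) = \<xi> k"
      using params(1) by (simp add: \<xi>_def algebra_simps)
    have "x (Suc k) = prox \<alpha> f1 (?xb - \<alpha> *\<^sub>R ?d)" using steps(2)[OF k] Option1 by simp
    with prox_subgradient[OF f1 params(1), of "?xb - \<alpha> *\<^sub>R ?d"] * Option1 show ?thesis by simp
  next
    case Option2
    let ?\<gamma> = "\<alpha> * ?T"
    have \<gamma>: "?\<gamma> > 0" using T params(1) by simp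
    have *: "(1 / ?\<gamma>) *\<^sub>R ((u k - ?\<gamma> *\<^sub>R ?d) - u (Suc k)) = \<xi> k"
      using T params(1) by (simp add: \<xi>_def algebra_simps)
    have "u (Suc k) = prox ?\<gamma> f1 (u k - ?\<gamma> *\<^sub>R ?d)" using steps(2)[OF k] Option2 by simp
    with prox_subgradient[OF f1 \<gamma>, of "u k - ?\<gamma> *\<^sub>R ?d"] * Option2 show ?thesis by simp
  qed
qed

lemma x_effdom: "x k \<in> effdom f1"
proof (induction k)
  case 0
  then show ?case using init by simp
next
  case (Suc k)
  show ?case
  proof (cases "k = 0")
    case True
    then show ?thesis using init by simp
  next
    case False
    then have k: "k \<ge> 1" by simp
    have dom: "(case opt of Option1 \<Rightarrow> x (Suc k) | Option2 \<Rightarrow> u (Suc k)) \<in> effdom f1"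
      using x_step_subgradient[OF k] by (simp add: subdifferential_def)
    show ?thesis
    proof (cases opt)
      case Option2
      then show ?thesis
        using avg_in_effdom(1)[OF f1(1,3) t_ge_1 x_avg[of "Suc k"]] Suc dom by simp
    qed (use dom in simp)
  qed
qed

text \<open>For Option 1 the subgradient inequality at \<open>x (Suc k)\<close> is used twice, towards \<open>x k\<close> with weight
  \<open>t (Suc k) - 1\<close> and towards \<open>a\<close> with weight 1; for Option 2 it is used once, at \<open>u (Suc k)\<close>, together
  with convexity along the average.\<close>
lemma x_step_inequality:
  assumes k: "k \<ge> 1" and a: "a \<in> effdom f1"
  shows "t (Suc k) * real_of_ereal (f1 (x (Suc k)))
    \<le> (t (Suc k) - 1) * real_of_ereal (f1 (x k)) + real_of_ereal (f1 a) + \<xi> k \<bullet> (u (Suc k) - a)"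
proof -
  let ?T = "t (Suc k)" and ?f = "\<lambda>a. real_of_ereal (f1 a)"
  have T: "?T \<ge> 1" using t_ge_1[of "Suc k"] by simp
  note avg = x_avg[of "Suc k", simplified]
  note sub = x_step_subgradient[OF k]
  show ?thesis
  proof (cases opt)
    case Option1
    have s: "?f (x (Suc k)) + \<xi> k \<bullet> (w - x (Suc k)) \<le> ?f w" if "w \<in> effdom f1" for w
      using subdifferentialD[OF f1(1) _ that] sub Option1 by simp
    have "(?T - 1) * (?f (x (Suc k)) + \<xi> k \<bullet> (x k - x (Suc k))) \<le> (?T - 1) * ?f (x k)"
      using s[OF x_effdom] T by (intro mult_left_mono) auto
    with s[OF a] have "?T * ?f (x (Suc k))
        + \<xi> k \<bullet> ((?T - 1) *\<^sub>R (x k - x (Suc k)) + (a - x (Suc k))) \<le> (?T - 1) * ?f (x k) + ?f a"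
      by (simp add: inner_add_right) (simp add: algebra_simps)
    moreover have "(?T - 1) *\<^sub>R (x k - x (Suc k)) + (a - x (Suc k)) = - (u (Suc k) - a)"
      using avg by (simp add: algebra_simps)
    ultimately show ?thesis by (simp add: inner_diff_right)
  next
    case Option2
    then have u: "u (Suc k) \<in> effdom f1" using sub by (simp add: subdifferential_def)
    have "?f (u (Suc k)) + \<xi> k \<bullet> (a - u (Suc k)) \<le> ?f a"
      using subdifferentialD[OF f1(1) _ a] sub Option2 by simp
    with avg_in_effdom(2)[OF f1(1,3) T avg x_effdom u] show ?thesis
      by (simp add: inner_diff_right)
  qed
qed

lemma K_transpose: "(transpose K *v w) \<bullet> z = w \<bullet> (K *v z)"
  by (simp add: transpose_matrix_vector dot_lmul_matrix)

lemma primal_step: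
  assumes k: "k \<ge> 1" and a: "a \<in> effdom f1"
  shows "(t (Suc k))\<^sup>2 * (F (x (Suc k)) - F a) + 1 / (2 * \<alpha>) * (norm (u (Suc k) - a))\<^sup>2
    \<le> ((t (Suc k))\<^sup>2 - t (Suc k)) * (F (x k) - F a) + 1 / (2 * \<alpha>) * (norm (u k - a))\<^sup>2
      - (1 - \<alpha> * Lf2) / (2 * \<alpha>) * (norm (u (Suc k) - u k))\<^sup>2
      - t (Suc k) * (dual_extrapolate t v k \<bullet> (K *v (u (Suc k) - a)))"
proof -
  let ?T = "t (Suc k)" and ?u' = "u (Suc k)" and ?xb = "extrapolate t x k"
  have T: "?T \<ge> 1" using t_ge_1[of "Suc k"] by simp
  have main: "?T\<^sup>2 * (F (x (Suc k)) - F a)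
      \<le> (?T\<^sup>2 - ?T) * (F (x k) - F a) + ?T * ((\<xi> k + Df2 ?xb) \<bullet> (?u' - a))
        - ?T * 0 / 2 * (norm (?u' - a))\<^sup>2 + Lf2 / 2 * (norm (?u' - u k))\<^sup>2"
    unfolding F_def
    by (rule inertial_composite_step[OF T x_avg[of "Suc k", simplified] extrapolate_avg[OF k x_avg[OF k]]
        f2(1-3)]) (use x_step_inequality[OF k a] in simp)
  have "?T * ((\<xi> k + Df2 ?xb) \<bullet> (?u' - a))
      = - (1 / \<alpha>) * ((?u' - u k) \<bullet> (?u' - a)) - ?T * (dual_extrapolate t v k \<bullet> (K *v (?u' - a)))"
  proof -
    have "\<xi> k + Df2 ?xb = - (1 / (\<alpha> * ?T)) *\<^sub>R (?u' - u k) - transpose K *v dual_extrapolate t v k"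
      by (simp add: \<xi>_def)
    then have "(\<xi> k + Df2 ?xb) \<bullet> (?u' - a)
        = - (1 / (\<alpha> * ?T)) * ((?u' - u k) \<bullet> (?u' - a)) - dual_extrapolate t v k \<bullet> (K *v (?u' - a))"
      by (simp only: inner_diff_left[of "_ *\<^sub>R _"] inner_scaleR_left K_transpose)
    then show ?thesis using T by (simp add: right_diff_distrib)
  qed
  also have "\<dots> = - (1 / (2 * \<alpha>) * (norm (?u' - u k))\<^sup>2) - 1 / (2 * \<alpha>) * (norm (?u' - a))\<^sup>2
      + 1 / (2 * \<alpha>) * (norm (u k - a))\<^sup>2 - ?T * (dual_extrapolate t v k \<bullet> (K *v (?u' - a)))"
    unfolding inner_diff_polarization by (simp add: add_divide_distrib diff_divide_distrib)
  finally have cross: "?T * ((\<xi> k + Df2 ?xb) \<bullet> (?u' - a)) = \<dots>" .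
  have "(1 - \<alpha> * Lf2) / (2 * \<alpha>) = 1 / (2 * \<alpha>) - Lf2 / 2"
    using params(1) by (simp add: diff_divide_distrib)
  with main cross show ?thesis by (simp add: left_diff_distrib)
qed

text \<open>Strong convexity enters here: its term raises the coefficient of the squared distance of
  \<open>v (Suc k)\<close> to \<open>b\<close> to that of the next step, by \<open>t_Suc_square_le_mu\<close>.\<close>
lemma dual_step:
  assumes k: "k \<ge> 1" and b: "b \<in> effdom g1"
  shows "(t (Suc k))\<^sup>2 * (G (y (Suc k)) - G b) + (t (Suc (Suc k)))\<^sup>2 / (2 * \<beta>) * (norm (v (Suc k) - b))\<^sup>2
    \<le> ((t (Suc k))\<^sup>2 - t (Suc k)) * (G (y k) - G b) + (t (Suc k))\<^sup>2 / (2 * \<beta>) * (norm (v k - b))\<^sup>2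
      - ((t (Suc k))\<^sup>2 / (2 * \<beta>) - Lg2 / 2) * (norm (v (Suc k) - v k))\<^sup>2
      + t (Suc k) * ((K *v u (Suc k)) \<bullet> (v (Suc k) - b))"
proof -
  let ?T = "t (Suc k)" and ?v' = "v (Suc k)" and ?yb = "extrapolate t y k"
    and ?g = "\<lambda>a. real_of_ereal (g1 a)"
  define \<zeta> where "\<zeta> = - (?T / \<beta>) *\<^sub>R (?v' - v k) - (Dg2 ?yb - K *v u (Suc k))"
  have T: "?T \<ge> 1" using t_ge_1[of "Suc k"] by simp
  have \<gamma>: "\<beta> / ?T > 0" using T params(2) by simp
  let ?p = "v k - (\<beta> / ?T) *\<^sub>R (Dg2 ?yb - K *v u (Suc k))"
  have "?v' = prox (\<beta> / ?T) g1 ?p" using steps(3)[OF k] by (simp add: y_step_def)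
  moreover have "(1 / (\<beta> / ?T)) *\<^sub>R (?p - ?v') = \<zeta>"
    using T params(2) by (simp add: \<zeta>_def algebra_simps)
  ultimately have \<zeta>: "\<zeta> \<in> subdifferential g1 ?v'"
    using prox_subgradient[OF g1(1,2) g1_convex \<gamma>, of ?p] by simp
  have "?g ?v' + \<zeta> \<bullet> (b - ?v') + \<mu>g / 2 * (norm (b - ?v'))\<^sup>2 \<le> ?g b"
    by (rule strongly_convex_funD[OF g1(1,3) \<zeta> b])
  with avg_in_effdom(2)[OF g1(1) g1_convex T y_avg[of "Suc k", simplified]] y_v_effdom
  have step: "?T * ?g (y (Suc k))
      \<le> (?T - 1) * ?g (y k) + ?g b + \<zeta> \<bullet> (?v' - b) - \<mu>g / 2 * (norm (?v' - b))\<^sup>2"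
    by (fastforce simp: inner_diff_right norm_minus_commute)
  have main: "?T\<^sup>2 * (G (y (Suc k)) - G b)
      \<le> (?T\<^sup>2 - ?T) * (G (y k) - G b) + ?T * ((\<zeta> + Dg2 ?yb) \<bullet> (?v' - b))
        - ?T * \<mu>g / 2 * (norm (?v' - b))\<^sup>2 + Lg2 / 2 * (norm (?v' - v k))\<^sup>2"
    unfolding G_def
    by (rule inertial_composite_step[OF T y_avg[of "Suc k", simplified] extrapolate_avg[OF k y_avg[OF k]]
        g2(1-3) step])
  have "?T * ((\<zeta> + Dg2 ?yb) \<bullet> (?v' - b))
      = - (?T\<^sup>2 / \<beta>) * ((?v' - v k) \<bullet> (?v' - b)) + ?T * ((K *v u (Suc k)) \<bullet> (?v' - b))"
  proof -
    have "\<zeta> + Dg2 ?yb = - (?T / \<beta>) *\<^sub>R (?v' - v k) + K *v u (Suc k)" by (simp add: \<zeta>_def)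
    then have "(\<zeta> + Dg2 ?yb) \<bullet> (?v' - b)
        = - (?T / \<beta>) * ((?v' - v k) \<bullet> (?v' - b)) + (K *v u (Suc k)) \<bullet> (?v' - b)"
      by (simp only: inner_add_left[of "_ *\<^sub>R _"] inner_scaleR_left)
    then show ?thesis by (simp add: right_diff_distrib power2_eq_square mult.assoc)
  qed
  also have "\<dots> = - (?T\<^sup>2 / (2 * \<beta>) * (norm (?v' - v k))\<^sup>2) - ?T\<^sup>2 / (2 * \<beta>) * (norm (?v' - b))\<^sup>2
      + ?T\<^sup>2 / (2 * \<beta>) * (norm (v k - b))\<^sup>2 + ?T * ((K *v u (Suc k)) \<bullet> (?v' - b))"
    unfolding inner_diff_polarization
    by (simp add: add_divide_distrib diff_divide_distrib distrib_left right_diff_distrib)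
  finally have cross: "?T * ((\<zeta> + Dg2 ?yb) \<bullet> (?v' - b)) = \<dots>" .
  have "(t (Suc (Suc k)))\<^sup>2 / (2 * \<beta>) \<le> (?T\<^sup>2 + \<mu>g * \<beta> * ?T) / (2 * \<beta>)"
    using t_Suc_square_le_mu[of "Suc k"] params(2) by (intro divide_right_mono) auto
  also have "\<dots> = ?T\<^sup>2 / (2 * \<beta>) + ?T * \<mu>g / 2" using params(2) by (simp add: field_simps)
  finally have "(t (Suc (Suc k)))\<^sup>2 / (2 * \<beta>) * (norm (?v' - b))\<^sup>2
      \<le> (?T\<^sup>2 / (2 * \<beta>) + ?T * \<mu>g / 2) * (norm (?v' - b))\<^sup>2" by (rule mult_right_mono) simp
  then have "(t (Suc (Suc k)))\<^sup>2 / (2 * \<beta>) * (norm (?v' - b))\<^sup>2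
      \<le> ?T\<^sup>2 / (2 * \<beta>) * (norm (?v' - b))\<^sup>2 + ?T * \<mu>g / 2 * (norm (?v' - b))\<^sup>2"
    by (simp add: distrib_right)
  then show ?thesis using main cross by (simp add: left_diff_distrib)
qed

section \<open>The Lyapunov energy\<close>

text \<open>Young's inequality with weight \<open>\<rho> = (1 - \<alpha> * Lf2) / (2 * \<alpha>)\<close> on the primal difference leaves
  \<open>(onorm K)\<^sup>2 / (4 * \<rho>)\<close> on the dual one; \<open>\<rho>\<close> is the coefficient with which \<open>primal_step\<close> provides
  the squared primal difference.\<close>
definition cross_weight :: real where
  "cross_weight = \<alpha> * (onorm ((*v) K))\<^sup>2 / (2 * (1 - \<alpha> * Lf2))"

text \<open>The bilinear term is the one that telescopes; the last term stores the squared dual difference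
  that pays for the bilinear remainder of the following step. Both vanish for \<open>k = 1\<close>, as \<open>v 1 = v 0\<close>.\<close>
definition energy :: "real^'n \<Rightarrow> real^'m \<Rightarrow> nat \<Rightarrow> real" where
  "energy a b k = (t k)\<^sup>2 * gap a b k + 1 / (2 * \<alpha>) * (norm (u k - a))\<^sup>2
     + (t (Suc k))\<^sup>2 / (2 * \<beta>) * (norm (v k - b))\<^sup>2
     - t k * ((K *v (u k - a)) \<bullet> (v k - v (k - 1)))
     + cross_weight * ((t k)\<^sup>2 * (norm (v k - v (k - 1)))\<^sup>2)"

lemma alpha_Lf2: "0 < 1 - \<alpha> * Lf2"
  using params(5) f2(4) by (simp add: field_simps)

lemma coupling_bound:
  "\<bar>s * ((K *v w) \<bullet> d)\<bar> \<le> (1 - \<alpha> * Lf2) / (2 * \<alpha>) * (norm w)\<^sup>2 + cross_weight * (s\<^sup>2 * (norm d)\<^sup>2)"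
proof -
  have "\<bar>(K *v w) \<bullet> d\<bar> \<le> norm (K *v w) * norm d" by (rule Cauchy_Schwarz_ineq2)
  also have "\<dots> \<le> onorm ((*v) K) * norm w * norm d"
    by (intro mult_right_mono onorm[OF matrix_vector_mul_bounded_linear]) simp
  finally have "\<bar>(K *v w) \<bullet> d\<bar> \<le> onorm ((*v) K) * norm w * norm d" .
  from cross_term_young[OF _ this, of "(1 - \<alpha> * Lf2) / (2 * \<alpha>)" s] alpha_Lf2 params(1)
  have "\<bar>s * ((K *v w) \<bullet> d)\<bar> \<le> (1 - \<alpha> * Lf2) / (2 * \<alpha>) * (norm w)\<^sup>2
      + (onorm ((*v) K))\<^sup>2 / (4 * ((1 - \<alpha> * Lf2) / (2 * \<alpha>))) * (s\<^sup>2 * (norm d)\<^sup>2)" by simp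
  also have "(onorm ((*v) K))\<^sup>2 / (4 * ((1 - \<alpha> * Lf2) / (2 * \<alpha>))) = cross_weight"
    using alpha_Lf2 params(1) by (simp add: cross_weight_def field_simps)
  finally show ?thesis .
qed

text \<open>The dual half of the parameter condition: the squared difference of \<open>v\<close> provided by
  \<open>dual_step\<close> suffices to refill the last term of the energy. As \<open>t\<close> increases, it is enough to
  require this for \<open>t 1\<close>.\<close>
lemma cross_weight_le:
  assumes "k \<ge> 1"
  shows "cross_weight * (t k)\<^sup>2 \<le> (t k)\<^sup>2 / (2 * \<beta>) - Lg2 / 2"
proof -
  have t: "0 < t 1" "t 1 \<le> t k" "0 < t k" using params(3) t_ge_t1[OF assms] by auto
  have "\<beta> * Lg2 / (t k)\<^sup>2 \<le> \<beta> * Lg2 / (t 1)\<^sup>2"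
    using t params(2) g2(4) by (intro divide_left_mono power_mono) auto
  then have "(1 - \<alpha> * Lf2) * (1 - \<beta> * Lg2 / (t 1)\<^sup>2) \<le> (1 - \<alpha> * Lf2) * (1 - \<beta> * Lg2 / (t k)\<^sup>2)"
    using alpha_Lf2 by (intro mult_left_mono) auto
  with params(4) have "\<beta> * (\<alpha> * (onorm ((*v) K))\<^sup>2) \<le> (1 - \<alpha> * Lf2) * (1 - \<beta> * Lg2 / (t k)\<^sup>2)"
    by (simp add: mult_ac)
  then have "\<beta> * (\<alpha> * (onorm ((*v) K))\<^sup>2) / (1 - \<alpha> * Lf2) \<le> 1 - \<beta> * Lg2 / (t k)\<^sup>2"
    using alpha_Lf2 by (simp add: pos_divide_le_eq mult.commute)
  moreover have "2 * \<beta> * cross_weight = \<beta> * (\<alpha> * (onorm ((*v) K))\<^sup>2) / (1 - \<alpha> * Lf2)"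
    using alpha_Lf2 by (simp add: cross_weight_def field_simps)
  ultimately have "(2 * \<beta> * cross_weight) * (t k)\<^sup>2 \<le> (1 - \<beta> * Lg2 / (t k)\<^sup>2) * (t k)\<^sup>2"
    by (intro mult_right_mono) auto
  also have "\<dots> = (t k)\<^sup>2 - \<beta> * Lg2" using t by (simp add: left_diff_distrib)
  finally have "cross_weight * (t k)\<^sup>2 \<le> ((t k)\<^sup>2 - \<beta> * Lg2) / (2 * \<beta>)"
    using params(2) by (simp add: pos_le_divide_eq mult_ac)
  then show ?thesis using params(2) by (simp add: diff_divide_distrib)
qed

text \<open>The bilinear part of the gap obeys the weights \<open>t\<^sup>2\<close> and \<open>t\<^sup>2 - t\<close> with equality, by linearity along
  the averages.\<close>
lemma gap_Suc:
  assumes k: "k \<ge> 1"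
  shows "(t (Suc k))\<^sup>2 * gap a b (Suc k) - ((t (Suc k))\<^sup>2 - t (Suc k)) * gap a b k
    = (t (Suc k))\<^sup>2 * (F (x (Suc k)) - F a) - ((t (Suc k))\<^sup>2 - t (Suc k)) * (F (x k) - F a)
    + ((t (Suc k))\<^sup>2 * (G (y (Suc k)) - G b) - ((t (Suc k))\<^sup>2 - t (Suc k)) * (G (y k) - G b))
    + t (Suc k) * ((K *v u (Suc k)) \<bullet> b - (K *v a) \<bullet> v (Suc k))"
proof -
  let ?T = "t (Suc k)"
  have "K *v (?T *\<^sub>R x (Suc k)) = K *v ((?T - 1) *\<^sub>R x k + u (Suc k))"
    using x_avg[of "Suc k"] by simp
  then have "?T *\<^sub>R (K *v x (Suc k)) = (?T - 1) *\<^sub>R (K *v x k) + K *v u (Suc k)"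
    by (simp add: matrix_vector_right_distrib matrix_vector_mult_scaleR)
  then have "(?T *\<^sub>R (K *v x (Suc k))) \<bullet> b = ((?T - 1) *\<^sub>R (K *v x k) + K *v u (Suc k)) \<bullet> b" by simp
  then have X: "?T * ((K *v x (Suc k)) \<bullet> b) = (?T - 1) * ((K *v x k) \<bullet> b) + (K *v u (Suc k)) \<bullet> b"
    by (simp only: inner_add_left inner_scaleR_left)
  have "(K *v a) \<bullet> (?T *\<^sub>R y (Suc k)) = (K *v a) \<bullet> ((?T - 1) *\<^sub>R y k + v (Suc k))"
    using y_avg[of "Suc k"] by simp
  then have Y: "?T * ((K *v a) \<bullet> y (Suc k)) = (?T - 1) * ((K *v a) \<bullet> y k) + (K *v a) \<bullet> v (Suc k)"
    by (simp only: inner_add_right inner_scaleR_right)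
  have "?T\<^sup>2 * ((K *v x (Suc k)) \<bullet> b) = ?T * ((?T - 1) * ((K *v x k) \<bullet> b) + (K *v u (Suc k)) \<bullet> b)"
    unfolding X[symmetric] by (simp add: power2_eq_square)
  moreover have "?T\<^sup>2 * ((K *v a) \<bullet> y (Suc k)) = ?T * ((?T - 1) * ((K *v a) \<bullet> y k) + (K *v a) \<bullet> v (Suc k))"
    unfolding Y[symmetric] by (simp add: power2_eq_square)
  ultimately show ?thesis
    by (simp add: gap_def Lag_def power2_eq_square algebra_simps)
qed

text \<open>The sum of \<open>gap_Suc\<close>, \<open>primal_step\<close> and \<open>dual_step\<close>. The factor in front of the gap is the
  mismatch between the weight \<open>t\<^sup>2 - t\<close> of the new step and the weight carried by the energy.\<close>
lemma energy_Suc_le: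
  assumes k: "k \<ge> 1" and a: "a \<in> effdom f1" and b: "b \<in> effdom g1"
  shows "energy a b (Suc k)
    \<le> energy a b k + ((t (Suc k))\<^sup>2 - t (Suc k) - (t k)\<^sup>2) * gap a b k"
proof -
  let ?T = "t (Suc k)" and ?u' = "u (Suc k)" and ?v' = "v (Suc k)"
  let ?w = "dual_extrapolate t v k" and ?d = "v k - v (k - 1)"
  have T: "?T > 0" using t_ge_1[of "Suc k"] by simp
  have "?T *\<^sub>R ?w = ?T *\<^sub>R v k + t k *\<^sub>R ?d"
    using T by (simp add: dual_extrapolate_def scaleR_add_right)
  then have "(?T *\<^sub>R ?w) \<bullet> (K *v (?u' - a)) = (?T *\<^sub>R v k + t k *\<^sub>R ?d) \<bullet> (K *v (?u' - a))" by simp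
  then have w: "?T * (?w \<bullet> (K *v (?u' - a)))
      = ?T * (v k \<bullet> (K *v (?u' - a))) + t k * (?d \<bullet> (K *v (?u' - a)))"
    by (simp only: inner_add_left inner_scaleR_left)
  have split: "K *v (?u' - a) = K *v (u k - a) + K *v (?u' - u k)"
    by (simp add: matrix_vector_right_distrib[symmetric])
  \<comment> \<open>All bilinear terms of the step, minus the bilinear term of the new energy, leave the
    bilinear term of the old energy and one remainder.\<close>
  have cross: "?T * ((K *v ?u') \<bullet> b - (K *v a) \<bullet> ?v') - ?T * (?w \<bullet> (K *v (?u' - a)))
      + ?T * ((K *v ?u') \<bullet> (?v' - b)) - ?T * ((K *v (?u' - a)) \<bullet> (?v' - v k))
      = - t k * ((K *v (u k - a)) \<bullet> ?d) - t k * ((K *v (?u' - u k)) \<bullet> ?d)"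
  proof -
    have "t k * (?d \<bullet> (K *v (?u' - a))) = t k * ((K *v (u k - a)) \<bullet> ?d) + t k * ((K *v (?u' - u k)) \<bullet> ?d)"
      unfolding split by (simp add: inner_add_right distrib_left inner_commute)
    moreover have "?T * ((K *v ?u') \<bullet> b - (K *v a) \<bullet> ?v') - ?T * (v k \<bullet> (K *v (?u' - a)))
      + ?T * ((K *v ?u') \<bullet> (?v' - b)) - ?T * ((K *v (?u' - a)) \<bullet> (?v' - v k)) = 0"
      by (simp add: matrix_vector_mult_diff_distrib inner_diff_left inner_diff_right inner_commute algebra_simps)
    ultimately show ?thesis unfolding w by simp
  qed
  have young: "- t k * ((K *v (?u' - u k)) \<bullet> ?d)
      \<le> (1 - \<alpha> * Lf2) / (2 * \<alpha>) * (norm (?u' - u k))\<^sup>2 + cross_weight * ((t k)\<^sup>2 * (norm ?d)\<^sup>2)"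
    using coupling_bound[of "t k" "?u' - u k" ?d] by linarith
  have "cross_weight * ?T\<^sup>2 * (norm (?v' - v k))\<^sup>2 \<le> (?T\<^sup>2 / (2 * \<beta>) - Lg2 / 2) * (norm (?v' - v k))\<^sup>2"
    using cross_weight_le[of "Suc k"] by (intro mult_right_mono) auto
  then have c: "cross_weight * (?T\<^sup>2 * (norm (?v' - v k))\<^sup>2) \<le> (?T\<^sup>2 / (2 * \<beta>) - Lg2 / 2) * (norm (?v' - v k))\<^sup>2"
    by (simp add: mult.assoc)
  have E: "energy a b k + (?T\<^sup>2 - ?T - (t k)\<^sup>2) * gap a b k = (?T\<^sup>2 - ?T) * gap a b k
      + 1 / (2 * \<alpha>) * (norm (u k - a))\<^sup>2 + ?T\<^sup>2 / (2 * \<beta>) * (norm (v k - b))\<^sup>2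
      - t k * ((K *v (u k - a)) \<bullet> ?d) + cross_weight * ((t k)\<^sup>2 * (norm ?d)\<^sup>2)"
    by (simp add: energy_def algebra_simps)
  have E': "energy a b (Suc k) = ?T\<^sup>2 * gap a b (Suc k)
      + 1 / (2 * \<alpha>) * (norm (?u' - a))\<^sup>2 + (t (Suc (Suc k)))\<^sup>2 / (2 * \<beta>) * (norm (?v' - b))\<^sup>2
      - ?T * ((K *v (?u' - a)) \<bullet> (?v' - v k)) + cross_weight * (?T\<^sup>2 * (norm (?v' - v k))\<^sup>2)"
    by (simp add: energy_def)
  show ?thesis
    unfolding E E'
    using gap_Suc[OF k, of a b] primal_step[OF k a] dual_step[OF k b] cross young c
    by linarith
qed

text \<open>Young's inequality with the same weights bounds the bilinear term. It consumes only the part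
  \<open>(1 - \<alpha> * Lf2) / (2 * \<alpha>)\<close> of \<open>1 / (2 * \<alpha>)\<close>; the rest, \<open>Lf2 / 2\<close>, is what keeps \<open>u\<close> bounded.\<close>
lemma energy_lower_bound:
  assumes "k \<ge> 1"
  shows "(t k)\<^sup>2 * gap a b k + Lf2 / 2 * (norm (u k - a))\<^sup>2
      + (t (Suc k))\<^sup>2 / (2 * \<beta>) * (norm (v k - b))\<^sup>2 \<le> energy a b k"
proof -
  have "1 / (2 * \<alpha>) = (1 - \<alpha> * Lf2) / (2 * \<alpha>) + Lf2 / 2"
    using params(1) by (simp add: diff_divide_distrib)
  then have "1 / (2 * \<alpha>) * (norm (u k - a))\<^sup>2
      = (1 - \<alpha> * Lf2) / (2 * \<alpha>) * (norm (u k - a))\<^sup>2 + Lf2 / 2 * (norm (u k - a))\<^sup>2"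
    by (simp only: distrib_right)
  with coupling_bound[of "t k" "u k - a" "v k - v (k - 1)"] show ?thesis
    unfolding energy_def by linarith
qed

lemma energy_1:
  "energy a b 1 = (t 1)\<^sup>2 * gap a b 1 + (1 / (2 * \<alpha>) * (norm (x 1 - a))\<^sup>2
     + (t 2)\<^sup>2 / (2 * \<beta>) * (norm (y 1 - b))\<^sup>2)"
  using init by (simp add: energy_def numeral_2_eq_2)

lemma energy_le_initial:
  assumes a: "a \<in> effdom f1" and b: "b \<in> effdom g1"
    and pos: "\<And>k. k \<ge> 1 \<Longrightarrow> ((t (Suc k))\<^sup>2 - t (Suc k) - (t k)\<^sup>2) * gap a b k \<le> 0"
    and k: "k \<ge> 1"
  shows "energy a b k \<le> energy a b 1"
  using k
proof (induction k rule: nat_induct_at_least)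
  case (Suc k)
  then show ?case using energy_Suc_le[OF _ a b, of k] pos[of k] by linarith
qed simp

lemma gap_le_of_large_strong_convexity:
  assumes "\<beta> * \<mu>g > 1 + 1 / t 1" "a \<in> effdom f1" "b \<in> effdom g1" "k \<ge> 1"
  shows "(t k)\<^sup>2 * gap a b k \<le> energy a b 1"
proof -
  have "energy a b k \<le> energy a b 1"
    using t_Suc_square_eq[OF assms(1)] assms by (intro energy_le_initial) auto
  moreover have "0 \<le> Lf2 / 2 * (norm (u k - a))\<^sup>2" "0 \<le> (t (Suc k))\<^sup>2 / (2 * \<beta>) * (norm (v k - b))\<^sup>2"
    using f2(4) params(2) by auto
  ultimately show ?thesis using energy_lower_bound[OF assms(4), of a b] by linarith
qed

section \<open>Rates relative to a saddle point\<close>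

text \<open>The saddle point property with both competitors restricted to the effective domains, where the
  Lagrangian is real. Outside of them the inequalities hold by the infinite values.\<close>
definition saddle :: "real^'n \<Rightarrow> real^'m \<Rightarrow> bool" where
  "saddle a b \<longleftrightarrow> a \<in> effdom f1 \<and> b \<in> effdom g1 \<and>
     (\<forall>a'\<in>effdom f1. \<forall>b'\<in>effdom g1. Lag a b' \<le> Lag a b \<and> Lag a b \<le> Lag a' b)"

text \<open>The dual component minimises \<open>g1\<close> plus a smooth function, so Fermat's rule provides a subgradient
  of \<open>g1\<close> at which strong convexity can be invoked.\<close>
lemma saddle_strong:
  assumes s: "saddle a b" and b': "b' \<in> effdom g1"
  shows "Lag a b' + \<mu>g / 2 * (norm (b' - b))\<^sup>2 \<le> Lag a b"
proof -
  let ?g = "\<lambda>b. real_of_ereal (g1 b)"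
  let ?\<phi> = "\<lambda>z. g2 z - (K *v a) \<bullet> z"
  have b: "b \<in> effdom g1" and a: "a \<in> effdom f1" using s by (auto simp: saddle_def)
  have min: "g1 b + ereal (?\<phi> b) \<le> g1 z + ereal (?\<phi> z)" for z
  proof (cases "z \<in> effdom g1")
    case True
    then have "Lag a z \<le> Lag a b" using s a by (auto simp: saddle_def)
    then have "?g b + ?\<phi> b \<le> ?g z + ?\<phi> z" by (simp add: Lag_def G_def)
    then show ?thesis using effdom_real_of_ereal[OF g1(1) b] effdom_real_of_ereal[OF g1(1) True]
      by (metis ereal_less_eq(3) plus_ereal.simps(1))
  qed (simp add: not_in_effdom)
  have "GDERIV (\<lambda>z. (K *v a) \<bullet> z) b :> K *v a"
    unfolding gderiv_def by (auto intro!: derivative_eq_intros simp: inner_commute)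
  then have "GDERIV ?\<phi> b :> Dg2 b - K *v a" by (intro GDERIV_diff g2(2))
  from minimizer_subgradient[where \<phi> = ?\<phi>, OF g1(1) g1_convex b min this]
  have "- (Dg2 b - K *v a) \<in> subdifferential g1 b" .
  from strongly_convex_funD[OF g1(1,3) this b'] convex_above_tangent[OF g2(1,2), of b b']
  show ?thesis by (simp add: Lag_def G_def inner_diff_left inner_diff_right)
qed

text \<open>The saddle inequalities at both points chain up to \<open>Lag a b \<le> Lag a b'\<close>, which contradicts the
  quadratic decay of \<open>saddle_strong\<close> unless \<open>b' = b\<close>.\<close>
lemma saddle_dual_unique:
  assumes "saddle a b" "saddle a' b'"
  shows "b' = b"
proof -
  have dom: "a \<in> effdom f1" "b \<in> effdom g1" "a' \<in> effdom f1" "b' \<in> effdom g1"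
    using assms by (auto simp: saddle_def)
  have "Lag a b \<le> Lag a' b" "Lag a' b \<le> Lag a' b'" "Lag a' b' \<le> Lag a b'"
    using assms dom by (auto simp: saddle_def)
  with saddle_strong[OF assms(1) dom(4)] have "\<mu>g / 2 * (norm (b' - b))\<^sup>2 \<le> 0" by linarith
  then show ?thesis using g1(4) by (simp add: mult_le_0_iff)
qed

context
  fixes xs ys assumes saddle: "saddle xs ys"
begin

lemma saddle_dom: "xs \<in> effdom f1" "ys \<in> effdom g1" using saddle by (auto simp: saddle_def)

lemma gap_ge: "\<mu>g / 2 * (norm (y k - ys))\<^sup>2 \<le> gap xs ys k"
proof -
  have "Lag xs ys \<le> Lag (x k) ys" using saddle x_effdom saddle_dom by (auto simp: saddle_def)
  with saddle_strong[OF saddle, of "y k"] y_v_effdom show ?thesis by (fastforce simp: gap_def)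
qed

lemma gap_nonneg: "0 \<le> gap xs ys k"
  using gap_ge[of k] g1(4) by (meson mult_nonneg_nonneg order_trans zero_le_power2 divide_nonneg_pos less_imp_le zero_less_numeral)

lemma energy_le: "k \<ge> 1 \<Longrightarrow> energy xs ys k \<le> energy xs ys 1"
  using t_Suc_square_le gap_nonneg saddle_dom
  by (intro energy_le_initial) (auto intro!: mult_nonpos_nonneg)

lemma rates:
  assumes k: "k \<ge> 1"
  shows "(t k)\<^sup>2 * gap xs ys k \<le> energy xs ys 1"
    and "Lf2 / 2 * (norm (u k - xs))\<^sup>2 \<le> energy xs ys 1"
    and "(t (Suc k))\<^sup>2 / (2 * \<beta>) * (norm (v k - ys))\<^sup>2 \<le> energy xs ys 1"
    and "(t k)\<^sup>2 * (\<mu>g / 2 * (norm (y k - ys))\<^sup>2) \<le> energy xs ys 1"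
proof -
  have "0 \<le> (t k)\<^sup>2 * gap xs ys k" "0 \<le> Lf2 / 2 * (norm (u k - xs))\<^sup>2"
    "0 \<le> (t (Suc k))\<^sup>2 / (2 * \<beta>) * (norm (v k - ys))\<^sup>2"
    using gap_nonneg f2(4) params(2) by auto
  with energy_lower_bound[OF k, of xs ys] energy_le[OF k]
  show *: "(t k)\<^sup>2 * gap xs ys k \<le> energy xs ys 1"
    and "Lf2 / 2 * (norm (u k - xs))\<^sup>2 \<le> energy xs ys 1"
    and "(t (Suc k))\<^sup>2 / (2 * \<beta>) * (norm (v k - ys))\<^sup>2 \<le> energy xs ys 1"
    by linarith+
  have "(t k)\<^sup>2 * (\<mu>g / 2 * (norm (y k - ys))\<^sup>2) \<le> (t k)\<^sup>2 * gap xs ys k"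
    using gap_ge by (intro mult_left_mono) auto
  with * show "(t k)\<^sup>2 * (\<mu>g / 2 * (norm (y k - ys))\<^sup>2) \<le> energy xs ys 1" by linarith
qed

lemma energy_1_nonneg: "0 \<le> energy xs ys 1"
proof -
  have "0 \<le> (t 1)\<^sup>2 * gap xs ys 1" using gap_nonneg by simp
  then show ?thesis using rates(1)[of 1] by simp
qed

lemma u_v_y_decay:
  assumes k: "k \<ge> 1"
  shows "norm (u k - xs) \<le> sqrt (energy xs ys 1 / (Lf2 / 2))"
    and "norm (v k - ys) \<le> sqrt (energy xs ys 1 / (1 / (2 * \<beta>))) / t (Suc k)"
    and "norm (y k - ys) \<le> sqrt (energy xs ys 1 / (\<mu>g / 2)) / t k"
proof -
  have t: "t k > 0" "t (Suc k) > 0" using t_ge_1[OF k] t_ge_1[of "Suc k"] by auto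
  show "norm (u k - xs) \<le> sqrt (energy xs ys 1 / (Lf2 / 2))"
    using norm_le_of_rate[of "Lf2 / 2" 1 "norm (u k - xs)" "energy xs ys 1"] rates(2)[OF k] f2(4) by simp
  show "norm (v k - ys) \<le> sqrt (energy xs ys 1 / (1 / (2 * \<beta>))) / t (Suc k)"
    by (rule norm_le_of_rate) (use rates(3)[OF k] params(2) t in auto)
  show "norm (y k - ys) \<le> sqrt (energy xs ys 1 / (\<mu>g / 2)) / t k"
    by (rule norm_le_of_rate) (use rates(4)[OF k] g1(4) t in \<open>auto simp: mult_ac\<close>)
qed

text \<open>Every \<open>x k\<close> is an average of \<open>x (k - 1)\<close> and \<open>u k\<close>, so a ball that contains \<open>x 0\<close> and all \<open>u k\<close> also
  contains all \<open>x k\<close>.\<close>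
lemma x_bounded: "\<exists>R. \<forall>k. norm (x k - xs) \<le> R \<and> (k \<ge> 1 \<longrightarrow> norm (u k - xs) \<le> R)"
proof -
  define R where "R = max (norm (x 0 - xs)) (sqrt (energy xs ys 1 / (Lf2 / 2)))"
  have u: "norm (u k - xs) \<le> R" if "k \<ge> 1" for k using u_v_y_decay(1)[OF that] by (simp add: R_def)
  have "x k \<in> cball xs R" for k
  proof (induction k)
    case 0
    then show ?case by (simp add: R_def dist_norm norm_minus_commute)
  next
    case (Suc k)
    have "u (Suc k) \<in> cball xs R" using u[of "Suc k"] by (simp add: dist_norm norm_minus_commute)
    with Suc x_avg[of "Suc k"] t_ge_1[of "Suc k"] show ?case
      by (metis avg_mem_convex convex_cball diff_Suc_1 le_add1 plus_1_eq_Suc)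
  qed
  with u show ?thesis by (intro exI[of _ R]) (auto simp: dist_norm norm_minus_commute)
qed

lemma iterates_bounded: "bounded ((\<lambda>k. (x k, y k, u k, v k)) ` {1..})"
proof -
  obtain R where R: "\<And>k. norm (x k - xs) \<le> R" "\<And>k. k \<ge> 1 \<Longrightarrow> norm (u k - xs) \<le> R"
    using x_bounded by blast
  define S where "S = sqrt (energy xs ys 1 / (\<mu>g / 2))"
  define V where "V = sqrt (energy xs ys 1 / (1 / (2 * \<beta>)))"
  have nn: "0 \<le> S" "0 \<le> V" using energy_1_nonneg g1(4) params(2) by (auto simp: S_def V_def)
  have "(\<lambda>k. (x k, y k, u k, v k)) ` {1..} \<subseteq> cball xs R \<times> cball ys S \<times> cball xs R \<times> cball ys V"
  proof (rule image_subsetI)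
    fix k :: nat assume "k \<in> {1..}"
    then have k: "k \<ge> 1" by simp
    have t: "t k \<ge> 1" "t (Suc k) \<ge> 1" using t_ge_1[OF k] t_ge_1[of "Suc k"] by auto
    have "S / t k \<le> S / 1" "V / t (Suc k) \<le> V / 1" using nn t by (intro divide_left_mono; simp)+
    then have "norm (y k - ys) \<le> S" "norm (v k - ys) \<le> V"
      using u_v_y_decay(2,3)[OF k] by (simp_all add: S_def V_def)
    then show "(x k, y k, u k, v k) \<in> cball xs R \<times> cball ys S \<times> cball xs R \<times> cball ys V"
      using R(1)[of k] R(2)[OF k] by (auto simp: dist_norm norm_minus_commute)
  qed
  then show ?thesis
    by (rule bounded_subset[rotated]) (intro bounded_Times bounded_cball)
qed

lemma x_increments: "\<exists>C. \<forall>k\<ge>1. norm (x k - x (k - 1)) \<le> C / t k"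
proof -
  obtain R where R: "\<And>k. norm (x k - xs) \<le> R" "\<And>k. k \<ge> 1 \<Longrightarrow> norm (u k - xs) \<le> R"
    using x_bounded by blast
  have "norm (x k - x (k - 1)) \<le> (2 * R) / t k" if k: "k \<ge> 1" for k
  proof -
    have t: "t k > 0" using t_ge_1[OF k] by simp
    have "t k *\<^sub>R (x k - x (k - 1)) = (u k - xs) - (x (k - 1) - xs)"
      unfolding scaleR_diff_right x_avg[OF k] by (simp add: algebra_simps)
    then have "norm (t k *\<^sub>R (x k - x (k - 1))) \<le> norm (u k - xs) + norm (x (k - 1) - xs)"
      by (metis norm_triangle_ineq4)
    also have "\<dots> \<le> 2 * R" using R(1)[of "k - 1"] R(2)[OF k] by simp
    finally show ?thesis using t by (simp add: pos_le_divide_eq mult.commute)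
  qed
  then show ?thesis by blast
qed

text \<open>The average gives \<open>t k *\<^sub>R (y k - y (k - 1)) = v k - y (k - 1)\<close>, and both \<open>v k\<close> and \<open>y (k - 1)\<close> approach
  \<open>ys\<close> like \<open>1 / t k\<close>; for the latter the index shift costs a factor 2, as \<open>t k \<le> t (k - 1) + 1\<close>.\<close>
lemma y_increments: "\<exists>C. \<forall>k\<ge>1. norm (y k - y (k - 1)) \<le> C / (t k)\<^sup>2"
proof -
  define S where "S = sqrt (energy xs ys 1 / (\<mu>g / 2))"
  define V where "V = sqrt (energy xs ys 1 / (1 / (2 * \<beta>)))"
  have nn: "0 \<le> S" "0 \<le> V" using energy_1_nonneg g1(4) params(2) by (auto simp: S_def V_def)
  have "norm (y k - y (k - 1)) \<le> (V + 2 * S) / (t k)\<^sup>2" if k: "k \<ge> 1" for k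
  proof (cases "k = 1")
    case True
    then show ?thesis using init(5) nn by simp
  next
    case False
    then have j: "k - 1 \<ge> 1" "Suc (k - 1) = k" using k by auto
    have t: "t k > 0" "t (k - 1) > 0" using t_ge_1[OF k] t_ge_1[OF j(1)] by auto
    have "t k \<le> t (k - 1) + 1" using t_Suc_le[OF j(1) j(1)] j(2) by simp
    then have tt: "t k \<le> 2 * t (k - 1)" using t_ge_1[OF j(1)] by simp
    have "V / t (Suc k) \<le> V / t k"
      using t_mono[OF k k] t nn by (intro divide_left_mono mult_pos_pos) auto
    moreover have "S / t (k - 1) \<le> 2 * S / t k"
    proof -
      have "2 * S / (2 * t (k - 1)) \<le> 2 * S / t k"
        using tt t nn by (intro divide_left_mono) auto
      then show ?thesis by simp
    qed
    moreover have "t k *\<^sub>R (y k - y (k - 1)) = (v k - ys) - (y (k - 1) - ys)"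
      unfolding scaleR_diff_right y_avg[OF k] by (simp add: algebra_simps)
    then have "norm (t k *\<^sub>R (y k - y (k - 1))) \<le> norm (v k - ys) + norm (y (k - 1) - ys)"
      by (metis norm_triangle_ineq4)
    ultimately have "t k * norm (y k - y (k - 1)) \<le> V / t k + 2 * S / t k"
      using u_v_y_decay(2)[OF k] u_v_y_decay(3)[OF j(1)] t by (simp add: S_def V_def)
    then have "norm (y k - y (k - 1)) \<le> (V / t k + 2 * S / t k) / t k"
      using t by (simp add: pos_le_divide_eq mult.commute)
    then show ?thesis by (simp add: add_divide_distrib power2_eq_square)
  qed
  then show ?thesis by blast
qed

end

section \<open>Limit points\<close>

lemma t_square_ge:
  assumes "\<beta> * \<mu>g > 1 + 1 / t 1" "k \<ge> 1"
  shows "real k \<le> (t k)\<^sup>2"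
  using assms(2)
proof (induction k rule: nat_induct_at_least)
  case base
  have "1\<^sup>2 \<le> (t 1)\<^sup>2" using params(3) by (intro power_mono) auto
  then show ?case by simp
next
  case (Suc k)
  then show ?case using t_Suc_square_eq[OF assms(1), of k] t_ge_1[of "Suc k"] by simp
qed

text \<open>For each pair \<open>a\<close>, \<open>b\<close> the gap at \<open>x k\<close>, \<open>y k\<close> is at most a constant divided by \<open>k\<close>, and it is
  lower semicontinuous in the iterates; in the limit \<open>Lag a' b \<le> Lag a b'\<close>. Taking \<open>b = b'\<close> and
  \<open>a = a'\<close> gives the two saddle inequalities. Closedness of the domains puts the limit into them.\<close>
lemma limit_point_saddle:
  assumes large: "\<beta> * \<mu>g > 1 + 1 / t 1" and r: "strict_mono (r :: nat \<Rightarrow> nat)"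
    and lim: "(\<lambda>i. (x (r i), y (r i))) \<longlonglongrightarrow> (a', b')"
  shows "saddle a' b'"
proof -
  let ?f = "\<lambda>a. real_of_ereal (f1 a)" and ?g = "\<lambda>b. real_of_ereal (g1 b)"
  have xl: "(\<lambda>i. x (r i)) \<longlonglongrightarrow> a'" and yl: "(\<lambda>i. y (r i)) \<longlonglongrightarrow> b'"
    using tendsto_fst[OF lim] tendsto_snd[OF lim] by simp_all
  have a': "a' \<in> effdom f1"
    using closed_sequentially[OF _ _ xl] f1(2) x_effdom by (auto simp: closed_fun_def)
  have b': "b' \<in> effdom g1"
    using closed_sequentially[OF _ _ yl] g1(2) y_v_effdom by (auto simp: closed_fun_def)
  have f2c: "isCont f2 a'" and g2c: "isCont g2 b'"
    using f2(2) g2(2) by (auto simp: gderiv_def intro: has_derivative_continuous)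
  have key: "Lag a' b \<le> Lag a b'" if a: "a \<in> effdom f1" and b: "b \<in> effdom g1" for a b
  proof (rule field_le_epsilon)
    fix e :: real assume e: "e > 0"
    let ?E = "energy a b 1"
    \<comment> \<open>The gap along the subsequence, with the nonsmooth parts replaced by their values at the
      limit minus \<open>e / 2\<close>: a convergent lower bound.\<close>
    let ?lo = "\<lambda>i. ?f a' - e / 2 + f2 (x (r i)) + (K *v x (r i)) \<bullet> b - G b
        - (F a + (K *v a) \<bullet> y (r i) - (?g b' - e / 2 + g2 (y (r i))))"
    have "?lo \<longlonglongrightarrow> ?f a' - e / 2 + f2 a' + (K *v a') \<bullet> b - G b
        - (F a + (K *v a) \<bullet> b' - (?g b' - e / 2 + g2 b'))"
      by (intro tendsto_intros isCont_tendsto_compose[OF f2c] isCont_tendsto_compose[OF g2c] xl yl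
          bounded_linear.tendsto[OF matrix_vector_mul_bounded_linear])
    moreover have "(\<lambda>i. \<bar>?E\<bar> / real (r i)) \<longlonglongrightarrow> 0"
      by (intro tendsto_divide_0[OF tendsto_const] filterlim_at_top_imp_at_infinity
          filterlim_compose[OF filterlim_real_sequentially] filterlim_subseq r)
    moreover have "\<forall>\<^sub>F i in sequentially. ?lo i \<le> \<bar>?E\<bar> / real (r i)"
    proof -
      have "\<forall>\<^sub>F i in sequentially. ?f a' - e / 2 < ?f (x (r i))"
        by (rule closed_fun_eventually_above[OF f1(1,2) xl x_effdom a']) (use e in simp)
      moreover have "\<forall>\<^sub>F i in sequentially. ?g b' - e / 2 < ?g (y (r i))"
        by (rule closed_fun_eventually_above[OF g1(1,2) yl _ b']) (use e y_v_effdom in auto)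
      moreover have "\<forall>\<^sub>F i in sequentially. 1 \<le> i" by (rule eventually_ge_at_top)
      ultimately show ?thesis
      proof eventually_elim
        case (elim i)
        have ri: "r i \<ge> 1" using seq_suble[OF r, of i] elim(3) by simp
        have t: "0 < (t (r i))\<^sup>2" using t_ge_1[OF ri] by simp
        have "gap a b (r i) \<le> ?E / (t (r i))\<^sup>2"
          using gap_le_of_large_strong_convexity[OF large a b ri] t
          by (simp add: pos_le_divide_eq mult.commute)
        also have "\<dots> \<le> \<bar>?E\<bar> / (t (r i))\<^sup>2" using t by (intro divide_right_mono) auto
        also have "\<dots> \<le> \<bar>?E\<bar> / real (r i)"
          using t_square_ge[OF large ri] ri t by (intro divide_left_mono) auto
        finally have "gap a b (r i) \<le> \<bar>?E\<bar> / real (r i)" .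
        with elim show ?case by (simp add: gap_def Lag_def F_def G_def)
      qed
    qed
    ultimately have "?f a' - e / 2 + f2 a' + (K *v a') \<bullet> b - G b
        - (F a + (K *v a) \<bullet> b' - (?g b' - e / 2 + g2 b')) \<le> 0"
      by (intro tendsto_le[OF sequentially_bot]) auto
    then show "Lag a' b \<le> Lag a b' + e" by (simp add: Lag_def F_def G_def)
  qed
  show ?thesis
    unfolding saddle_def using key[OF _ b'] key[OF a'] a' b' by blast
qed

section \<open>The extended-valued Lagrangian\<close>

abbreviation Lag_ereal :: "real^'n \<Rightarrow> real^'m \<Rightarrow> ereal" where
  "Lag_ereal \<equiv> lagrangian K (\<lambda>a. f1 a + ereal (f2 a)) (\<lambda>b. g1 b + ereal (g2 b))"

definition energy_ereal :: "real^'n \<Rightarrow> real^'m \<Rightarrow> ereal" where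
  "energy_ereal a b = ereal ((t 1)\<^sup>2) * (Lag_ereal (x 1) b - Lag_ereal a (y 1))
     + ereal (1 / (2 * \<alpha>) * (norm (x 1 - a))\<^sup>2 + (t 2)\<^sup>2 / (2 * \<beta>) * (norm (y 1 - b))\<^sup>2)"

lemma Lag_ereal_eq: "a \<in> effdom f1 \<Longrightarrow> b \<in> effdom g1 \<Longrightarrow> Lag_ereal a b = ereal (Lag a b)"
  using effdom_real_of_ereal[OF f1(1), of a] effdom_real_of_ereal[OF g1(1), of b]
  by (cases "f1 a"; cases "g1 b") (auto simp: lagrangian_def Lag_def F_def G_def)

lemma Lag_ereal_PInf: "a \<notin> effdom f1 \<Longrightarrow> b \<in> effdom g1 \<Longrightarrow> Lag_ereal a b = \<infinity>"
  using effdom_real_of_ereal[OF g1(1), of b]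
  by (cases "g1 b") (auto simp: lagrangian_def not_in_effdom)

lemma Lag_ereal_MInf: "a \<in> effdom f1 \<Longrightarrow> b \<notin> effdom g1 \<Longrightarrow> Lag_ereal a b = - \<infinity>"
  using effdom_real_of_ereal[OF f1(1), of a]
  by (cases "f1 a") (auto simp: lagrangian_def not_in_effdom)

text \<open>Points outside the effective domain are never better competitors, so optimality over a set in
  extended values is optimality over its part in the domain in real values.\<close>
lemma Lag_ereal_le_iff_dual:
  assumes "a \<in> effdom f1" "b \<in> effdom g1"
  shows "(\<forall>b'\<in>S. Lag_ereal a b' \<le> Lag_ereal a b) \<longleftrightarrow> (\<forall>b'\<in>S \<inter> effdom g1. Lag a b' \<le> Lag a b)"
proof -
  have "Lag_ereal a b' \<le> Lag_ereal a b \<longleftrightarrow> (b' \<in> effdom g1 \<longrightarrow> Lag a b' \<le> Lag a b)" for b'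
    using assms by (cases "b' \<in> effdom g1") (auto simp: Lag_ereal_eq Lag_ereal_MInf)
  then show ?thesis by blast
qed

lemma Lag_ereal_le_iff_primal:
  assumes "a \<in> effdom f1" "b \<in> effdom g1"
  shows "(\<forall>a'\<in>S. Lag_ereal a b \<le> Lag_ereal a' b) \<longleftrightarrow> (\<forall>a'\<in>S \<inter> effdom f1. Lag a b \<le> Lag a' b)"
proof -
  have "Lag_ereal a b \<le> Lag_ereal a' b \<longleftrightarrow> (a' \<in> effdom f1 \<longrightarrow> Lag a b \<le> Lag a' b)" for a'
    using assms by (cases "a' \<in> effdom f1") (auto simp: Lag_ereal_eq Lag_ereal_PInf)
  then show ?thesis by blast
qed

lemma saddle_points_iff:
  "(a, b) \<in> saddle_points K (\<lambda>a. f1 a + ereal (f2 a)) (\<lambda>b. g1 b + ereal (g2 b)) \<longleftrightarrow> saddle a b"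
proof (cases "a \<in> effdom f1 \<and> b \<in> effdom g1")
  case True
  then have "(\<forall>a' b'. Lag_ereal a b' \<le> Lag_ereal a b \<and> Lag_ereal a b \<le> Lag_ereal a' b)
      \<longleftrightarrow> (\<forall>b'\<in>UNIV. Lag_ereal a b' \<le> Lag_ereal a b) \<and> (\<forall>a'\<in>UNIV. Lag_ereal a b \<le> Lag_ereal a' b)" by blast
  then show ?thesis
    using True unfolding saddle_points_def saddle_def effdom_add_ereal
    by (subst (asm) Lag_ereal_le_iff_dual, simp, simp, subst (asm) Lag_ereal_le_iff_primal) auto
next
  case False
  then show ?thesis by (auto simp: saddle_points_def saddle_def effdom_add_ereal)
qed

lemma energy_ereal_eq: "a \<in> effdom f1 \<Longrightarrow> b \<in> effdom g1 \<Longrightarrow> energy_ereal a b = ereal (energy a b 1)"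
  using x_effdom y_v_effdom by (simp add: energy_ereal_def Lag_ereal_eq energy_1 gap_def del: One_nat_def)

lemma energy_ereal_MInf:
  assumes "\<not> (a \<in> effdom f1 \<and> b \<in> effdom g1)"
  shows "energy_ereal a b = - \<infinity>"
proof -
  have t: "(t 1)\<^sup>2 > 0" using params(3) by simp
  have "Lag_ereal (x 1) b - Lag_ereal a (y 1) = - \<infinity>"
  proof (cases "b \<in> effdom g1")
    case True
    then show ?thesis using assms x_effdom[of 1] y_v_effdom[of 1] by (simp add: Lag_ereal_eq Lag_ereal_PInf)
  next
    case False
    then show ?thesis using x_effdom[of 1] y_v_effdom[of 1]
      by (cases "a \<in> effdom f1") (simp_all add: Lag_ereal_MInf Lag_ereal_eq Lag_ereal_PInf)
  qed
  then show ?thesis using t by (simp add: energy_ereal_def)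
qed

lemma continuous_smooth_parts: "continuous_on UNIV f2" "continuous_on UNIV g2"
  using f2(2) g2(2)
  by (auto simp: gderiv_def intro!: continuous_at_imp_continuous_on has_derivative_continuous)

lemma Lag_ereal_attains_max_dual:
  assumes "compact B" "b0 \<in> B" "b0 \<in> effdom g1" and a: "a \<in> effdom f1"
  shows "\<exists>b\<in>B \<inter> effdom g1. \<forall>b'\<in>B. Lag_ereal a b' \<le> Lag_ereal a b"
proof -
  have "continuous_on UNIV (\<lambda>b. g2 b - (K *v a) \<bullet> b)"
    by (intro continuous_intros continuous_smooth_parts)
  from closed_fun_add_continuous_attains_inf_effdom[OF g1(1,2) this assms(1-3)]
  obtain b where b: "b \<in> B \<inter> effdom g1" and
    "\<And>b'. b' \<in> B \<inter> effdom g1 \<Longrightarrow> real_of_ereal (g1 b) + (g2 b - (K *v a) \<bullet> b)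
      \<le> real_of_ereal (g1 b') + (g2 b' - (K *v a) \<bullet> b')" by blast
  then have "\<forall>b'\<in>B \<inter> effdom g1. Lag a b' \<le> Lag a b" by (force simp: Lag_def G_def)
  then show ?thesis using b Lag_ereal_le_iff_dual[OF a, of b B] by blast
qed

lemma Lag_ereal_attains_min_primal:
  assumes "compact B" "a0 \<in> B" "a0 \<in> effdom f1" and b: "b \<in> effdom g1"
  shows "\<exists>a\<in>B \<inter> effdom f1. \<forall>a'\<in>B. Lag_ereal a b \<le> Lag_ereal a' b"
proof -
  have "continuous_on UNIV (\<lambda>a. f2 a + (K *v a) \<bullet> b)"
    by (intro continuous_intros continuous_smooth_parts
        linear_continuous_on matrix_vector_mul_bounded_linear)
  from closed_fun_add_continuous_attains_inf_effdom[OF f1(1,2) this assms(1-3)]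
  obtain a where a: "a \<in> B \<inter> effdom f1" and
    "\<And>a'. a' \<in> B \<inter> effdom f1 \<Longrightarrow> real_of_ereal (f1 a) + (f2 a + (K *v a) \<bullet> b)
      \<le> real_of_ereal (f1 a') + (f2 a' + (K *v a') \<bullet> b)" by blast
  then have "\<forall>a'\<in>B \<inter> effdom f1. Lag a b \<le> Lag a' b" by (force simp: Lag_def F_def)
  then show ?thesis using a Lag_ereal_le_iff_primal[OF _ b, of a B] by blast
qed

text \<open>The initial energy separates: up to a constant and a positive factor it is
  minus the sum of a function of \<open>a\<close> and a function of \<open>b\<close>, each of the form closed plus
  continuous. Minimising both separately maximises it jointly.\<close>
lemma energy_ereal_attains_max:
  assumes B: "compact B1" "compact B2" and a0: "a0 \<in> B1" "a0 \<in> effdom f1"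
    and b0: "b0 \<in> B2" "b0 \<in> effdom g1"
  shows "\<exists>a\<in>B1 \<inter> effdom f1. \<exists>b\<in>B2 \<inter> effdom g1. \<forall>a'\<in>B1. \<forall>b'\<in>B2. energy_ereal a' b' \<le> energy_ereal a b"
proof -
  let ?q = "\<lambda>a. f2 a + (K *v a) \<bullet> y 1 - 1 / (2 * \<alpha>) / (t 1)\<^sup>2 * (norm (x 1 - a))\<^sup>2"
  let ?r = "\<lambda>b. g2 b - (K *v x 1) \<bullet> b - (t 2)\<^sup>2 / (2 * \<beta>) / (t 1)\<^sup>2 * (norm (y 1 - b))\<^sup>2"
  let ?\<phi> = "\<lambda>a. real_of_ereal (f1 a) + ?q a" and ?\<psi> = "\<lambda>b. real_of_ereal (g1 b) + ?r b"
  have t: "(t 1)\<^sup>2 > 0" using params(3) by simp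
  have "continuous_on UNIV ?q"
    by (intro continuous_intros continuous_smooth_parts
        linear_continuous_on matrix_vector_mul_bounded_linear)
  from closed_fun_add_continuous_attains_inf_effdom[OF f1(1,2) this B(1) a0]
  obtain a where a: "a \<in> B1 \<inter> effdom f1" "\<And>a'. a' \<in> B1 \<inter> effdom f1 \<Longrightarrow> ?\<phi> a \<le> ?\<phi> a'" by blast
  have "continuous_on UNIV ?r" by (intro continuous_intros continuous_smooth_parts)
  from closed_fun_add_continuous_attains_inf_effdom[OF g1(1,2) this B(2) b0]
  obtain b where b: "b \<in> B2 \<inter> effdom g1" "\<And>b'. b' \<in> B2 \<inter> effdom g1 \<Longrightarrow> ?\<psi> b \<le> ?\<psi> b'" by blast
  have energy: "energy a' b' 1 = (t 1)\<^sup>2 * (F (x 1) + G (y 1) - ?\<phi> a' - ?\<psi> b')" for a' b'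
  proof -
    have "(t 1)\<^sup>2 * (1 / (2 * \<alpha>) / (t 1)\<^sup>2 * (norm (x 1 - a'))\<^sup>2) = 1 / (2 * \<alpha>) * (norm (x 1 - a'))\<^sup>2"
      "(t 1)\<^sup>2 * ((t 2)\<^sup>2 / (2 * \<beta>) / (t 1)\<^sup>2 * (norm (y 1 - b'))\<^sup>2) = (t 2)\<^sup>2 / (2 * \<beta>) * (norm (y 1 - b'))\<^sup>2"
      using t by simp_all
    then show ?thesis
      unfolding energy_1 gap_def Lag_def F_def[of a'] G_def[of b']
      by (simp only: distrib_left right_diff_distrib)
  qed
  have "energy_ereal a' b' \<le> energy_ereal a b" if "a' \<in> B1" "b' \<in> B2" for a' b'
  proof (cases "a' \<in> effdom f1 \<and> b' \<in> effdom g1")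
    case True
    then have "?\<phi> a \<le> ?\<phi> a'" "?\<psi> b \<le> ?\<psi> b'" using a(2) b(2) that by blast+
    then have "energy a' b' 1 \<le> energy a b 1"
      unfolding energy using t by (intro mult_left_mono diff_mono) auto
    then show ?thesis using True a(1) b(1) by (simp add: energy_ereal_eq)
  qed (simp add: energy_ereal_MInf)
  with a(1) b(1) show ?thesis by blast
qed

text \<open>The supremum and the infimum of the partial gap are attained at points \<open>b\<close> and \<open>a\<close> of the domains,
  where it becomes an ordinary gap and the bound by the initial energy at \<open>(a, b)\<close> applies.\<close>
lemma pd_gap_le:
  assumes large: "\<beta> * \<mu>g > 1 + 1 / t 1" and B: "compact B1" "compact B2"
    and a0: "a0 \<in> B1" "a0 \<in> effdom f1" and b0: "b0 \<in> B2" "b0 \<in> effdom g1" and k: "k \<ge> 1"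
  shows "pd_gap Lag_ereal B1 B2 (x k) (y k) \<le> (SUP (a, b)\<in>B1 \<times> B2. energy_ereal a b) / ereal ((t k)\<^sup>2)"
proof -
  have xk: "x k \<in> effdom f1" and yk: "y k \<in> effdom g1" using x_effdom y_v_effdom by auto
  have t: "(t k)\<^sup>2 > 0" using t_ge_1[OF k] by simp
  obtain b where b: "b \<in> B2 \<inter> effdom g1" "\<forall>b'\<in>B2. Lag_ereal (x k) b' \<le> Lag_ereal (x k) b"
    using Lag_ereal_attains_max_dual[OF B(2) b0 xk] by blast
  obtain a where a: "a \<in> B1 \<inter> effdom f1" "\<forall>a'\<in>B1. Lag_ereal a (y k) \<le> Lag_ereal a' (y k)"
    using Lag_ereal_attains_min_primal[OF B(1) a0 yk] by blast
  obtain c d where cd: "c \<in> B1 \<inter> effdom f1" "d \<in> B2 \<inter> effdom g1"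
    "\<And>a' b'. a' \<in> B1 \<Longrightarrow> b' \<in> B2 \<Longrightarrow> energy_ereal a' b' \<le> energy_ereal c d"
    using energy_ereal_attains_max[OF B a0 b0] by blast
  have S: "(SUP b'\<in>B2. Lag_ereal (x k) b') = ereal (Lag (x k) b)"
    using b xk by (intro SUP_eqI) (auto simp: Lag_ereal_eq[symmetric])
  have I: "(INF a'\<in>B1. Lag_ereal a' (y k)) = ereal (Lag a (y k))"
    using a yk by (intro INF_eqI) (auto simp: Lag_ereal_eq[symmetric])
  have M: "(SUP (a, b)\<in>B1 \<times> B2. energy_ereal a b) = ereal (energy c d 1)"
    using cd by (intro SUP_eqI) (auto simp: energy_ereal_eq[symmetric] simp del: One_nat_def)
  have "energy_ereal a b \<le> energy_ereal c d" using cd(3) a(1) b(1) by blast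
  then have "energy a b 1 \<le> energy c d 1" using a(1) b(1) cd by (simp add: energy_ereal_eq)
  moreover have "(t k)\<^sup>2 * gap a b k \<le> energy a b 1"
    using gap_le_of_large_strong_convexity[OF large _ _ k] a(1) b(1) by blast
  ultimately have "gap a b k \<le> energy c d 1 / (t k)\<^sup>2"
    using t by (simp add: pos_le_divide_eq mult.commute)
  then show ?thesis using t unfolding pd_gap_def S I M by (simp add: gap_def)
qed

end

section \<open>The convergence theorem\<close>

theorem theorem1:
  fixes K :: "real^'n^'m"
    and f1 f :: "real^'n \<Rightarrow> ereal" and f2 :: "real^'n \<Rightarrow> real" and Df2 :: "real^'n \<Rightarrow> real^'n"
    and g1 g :: "real^'m \<Rightarrow> ereal" and g2 :: "real^'m \<Rightarrow> real" and Dg2 :: "real^'m \<Rightarrow> real^'m"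
    and Lf2 Lg2 \<mu>g \<alpha> \<beta> :: real
    and opt :: x_update
    and t :: "nat \<Rightarrow> real"
    and x u :: "nat \<Rightarrow> real^'n" and y v :: "nat \<Rightarrow> real^'m"
    and L E1 :: "real^'n \<Rightarrow> real^'m \<Rightarrow> ereal"
    and \<Omega> :: "((real^'n) \<times> (real^'m)) set"
    and xs :: "real^'n" and ys :: "real^'m"
  assumes f_def: "f = (\<lambda>a. f1 a + ereal (f2 a))"
    and g_def: "g = (\<lambda>b. g1 b + ereal (g2 b))"
    and L_def: "L = lagrangian K f g"
    and \<Omega>_def: "\<Omega> = saddle_points K f g"
    and f1: "proper_fun f1" "closed_fun f1" "convex_fun f1"
    and g1: "proper_fun g1" "closed_fun g1" "strongly_convex_fun \<mu>g g1" "\<mu>g > 0"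
    and f2: "convex_on UNIV f2" "\<forall>a. GDERIV f2 a :> Df2 a" "Lf2-lipschitz_on UNIV Df2" "Lf2 > 0"
    and g2: "convex_on UNIV g2" "\<forall>b. GDERIV g2 b :> Dg2 b" "Lg2-lipschitz_on UNIV Dg2" "Lg2 > 0"
    and \<Omega>_nonempty: "\<Omega> \<noteq> {}"
    and params: "\<alpha> > 0" "\<beta> > 0" "t 1 \<ge> 1"
      "\<alpha> * \<beta> * (onorm ((*v) K))\<^sup>2 < (1 - \<alpha> * Lf2) * (1 - \<beta> * Lg2 / (t 1)\<^sup>2)"
      "\<alpha> < 1 / Lf2" "\<beta> < (t 1)\<^sup>2 / Lg2"
    and iterates: "inertial_pd_iterates opt K f1 Df2 g1 Dg2 \<mu>g \<alpha> \<beta> t x y u v"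
    and E1_def: "E1 = (\<lambda>a b. ereal ((t 1)\<^sup>2) * (L (x 1) b - L a (y 1))
      + ereal (1 / (2 * \<alpha>) * (norm (x 1 - a))\<^sup>2 + (t 2)\<^sup>2 / (2 * \<beta>) * (norm (y 1 - b))\<^sup>2))"
    and saddle: "(xs, ys) \<in> \<Omega>"
  shows
    \<comment> \<open>uniqueness of the dual component\<close>
    "(\<forall>x' y'. (x', y') \<in> \<Omega> \<longrightarrow> y' = ys) \<and>
    \<comment> \<open>(a); the maxima and the minimum in the gap and in \<open>D\<close> are attained\<close>
     (\<forall>k\<ge>1. L (x k) ys - L xs (y k) \<le> E1 xs ys / ereal ((t k)\<^sup>2)) \<and>
     (\<beta> * \<mu>g > 1 + 1 / t 1 \<longrightarrow>
       (\<forall>B1 B2. compact (B1 \<times> B2) \<and> (B1 \<times> B2) \<inter> \<Omega> \<noteq> {} \<longrightarrow>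
         (\<exists>a\<in>B1. \<exists>b\<in>B2. \<forall>a'\<in>B1. \<forall>b'\<in>B2. E1 a' b' \<le> E1 a b) \<and>
         (\<forall>k\<ge>1.
           (\<exists>b\<in>B2. \<forall>b'\<in>B2. L (x k) b' \<le> L (x k) b) \<and>
           (\<exists>a\<in>B1. \<forall>a'\<in>B1. L a (y k) \<le> L a' (y k)) \<and>
           pd_gap L B1 B2 (x k) (y k) \<le> (SUP (a, b)\<in>B1 \<times> B2. E1 a b) / ereal ((t k)\<^sup>2)))) \<and>
    \<comment> \<open>(b)\<close>
     bounded ((\<lambda>k. (x k, y k, u k, v k)) ` {1..}) \<and>
     (\<forall>k\<ge>1. ereal ((norm (y k - ys))\<^sup>2) \<le> 2 * E1 xs ys / ereal (\<mu>g * (t k)\<^sup>2)) \<and>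
     (\<forall>k\<ge>1. ereal ((norm (v k - ys))\<^sup>2) \<le> ereal (2 * \<beta>) * E1 xs ys / ereal ((t (k + 1))\<^sup>2)) \<and>
     (\<exists>C. \<forall>k\<ge>1. norm (x k - x (k - 1)) \<le> C / t k) \<and>
     (\<exists>C. \<forall>k\<ge>1. norm (y k - y (k - 1)) \<le> C / (t k)\<^sup>2) \<and>
    \<comment> \<open>(c)\<close>
     (\<beta> * \<mu>g > 1 + 1 / t 1 \<longrightarrow>
       (\<forall>x' y' (r :: nat \<Rightarrow> nat). strict_mono r \<and> (\<lambda>i. (x (r i), y (r i))) \<longlonglongrightarrow> (x', y') \<longrightarrow> (x', y') \<in> \<Omega>))"
proof -
  interpret inertial_primal_dual K f1 f2 Df2 g1 g2 Dg2 Lf2 Lg2 \<mu>g \<alpha> \<beta> opt t x u y v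
    using f1 g1 f2 g2 params iterates by unfold_locales auto
  have L: "L = Lag_ereal"
    using L_def f_def g_def by simp
  have E: "E1 = energy_ereal"
    unfolding E1_def energy_ereal_def[abs_def] L ..
  have Omega_iff: "(a, b) \<in> \<Omega> \<longleftrightarrow> saddle a b" for a b
    using \<Omega>_def f_def g_def saddle_points_iff by simp
  have s: "saddle xs ys" using saddle Omega_iff by simp
  note dom = saddle_dom[OF s]
  have Es: "E1 xs ys = ereal (energy xs ys 1)" using energy_ereal_eq[OF dom] E by simp
  have tpos: "t k > 0" if "k \<ge> 1" for k using t_ge_1[OF that] by simp
  have unique: "\<forall>x' y'. (x', y') \<in> \<Omega> \<longrightarrow> y' = ys"
    using Omega_iff saddle_dual_unique[OF s] by blast
  have gap_rate: "\<forall>k\<ge>1. L (x k) ys - L xs (y k) \<le> E1 xs ys / ereal ((t k)\<^sup>2)"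
  proof (intro allI impI)
    fix k :: nat assume k: "k \<ge> 1"
    have "gap xs ys k \<le> energy xs ys 1 / (t k)\<^sup>2"
      using rates(1)[OF s k] tpos[OF k] by (simp add: pos_le_divide_eq mult.commute)
    then show "L (x k) ys - L xs (y k) \<le> E1 xs ys / ereal ((t k)\<^sup>2)"
      using x_effdom[of k] y_v_effdom[of k] dom tpos[OF k] by (simp add: Es L Lag_ereal_eq gap_def)
  qed
  have pd: "\<beta> * \<mu>g > 1 + 1 / t 1 \<longrightarrow>
     (\<forall>B1 B2. compact (B1 \<times> B2) \<and> (B1 \<times> B2) \<inter> \<Omega> \<noteq> {} \<longrightarrow>
       (\<exists>a\<in>B1. \<exists>b\<in>B2. \<forall>a'\<in>B1. \<forall>b'\<in>B2. E1 a' b' \<le> E1 a b) \<and>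
       (\<forall>k\<ge>1.
         (\<exists>b\<in>B2. \<forall>b'\<in>B2. L (x k) b' \<le> L (x k) b) \<and>
         (\<exists>a\<in>B1. \<forall>a'\<in>B1. L a (y k) \<le> L a' (y k)) \<and>
         pd_gap L B1 B2 (x k) (y k) \<le> (SUP (a, b)\<in>B1 \<times> B2. E1 a b) / ereal ((t k)\<^sup>2)))"
  proof (intro impI allI, elim conjE)
    fix B1 :: "(real^'n) set" and B2 :: "(real^'m) set"
    assume large: "\<beta> * \<mu>g > 1 + 1 / t 1" and comp: "compact (B1 \<times> B2)"
      and ne: "(B1 \<times> B2) \<inter> \<Omega> \<noteq> {}"
    obtain a0 b0 where "a0 \<in> B1" "b0 \<in> B2" "(a0, b0) \<in> \<Omega>" using ne by auto
    then have a0: "a0 \<in> B1" "a0 \<in> effdom f1" and b0: "b0 \<in> B2" "b0 \<in> effdom g1"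
      using Omega_iff by (auto simp: saddle_def)
    have "compact (fst ` (B1 \<times> B2))" "compact (snd ` (B1 \<times> B2))"
      by (intro compact_continuous_image comp continuous_intros)+
    moreover have "fst ` (B1 \<times> B2) = B1" "snd ` (B1 \<times> B2) = B2"
      using a0(1) b0(1) by (auto simp: fst_image_times snd_image_times)
    ultimately have B: "compact B1" "compact B2" by simp_all
    show "(\<exists>a\<in>B1. \<exists>b\<in>B2. \<forall>a'\<in>B1. \<forall>b'\<in>B2. E1 a' b' \<le> E1 a b) \<and>
       (\<forall>k\<ge>1.
         (\<exists>b\<in>B2. \<forall>b'\<in>B2. L (x k) b' \<le> L (x k) b) \<and>
         (\<exists>a\<in>B1. \<forall>a'\<in>B1. L a (y k) \<le> L a' (y k)) \<and>
         pd_gap L B1 B2 (x k) (y k) \<le> (SUP (a, b)\<in>B1 \<times> B2. E1 a b) / ereal ((t k)\<^sup>2))"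
    proof (intro conjI allI impI)
      show "\<exists>a\<in>B1. \<exists>b\<in>B2. \<forall>a'\<in>B1. \<forall>b'\<in>B2. E1 a' b' \<le> E1 a b"
        using energy_ereal_attains_max[OF B a0 b0] unfolding E by blast
      fix k :: nat assume k: "k \<ge> 1"
      show "\<exists>b\<in>B2. \<forall>b'\<in>B2. L (x k) b' \<le> L (x k) b"
        using Lag_ereal_attains_max_dual[OF B(2) b0 x_effdom] unfolding L by blast
      have "y k \<in> effdom g1" using y_v_effdom by blast
      then show "\<exists>a\<in>B1. \<forall>a'\<in>B1. L a (y k) \<le> L a' (y k)"
        using Lag_ereal_attains_min_primal[OF B(1) a0] unfolding L by blast
      show "pd_gap L B1 B2 (x k) (y k) \<le> (SUP (a, b)\<in>B1 \<times> B2. E1 a b) / ereal ((t k)\<^sup>2)"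
        using pd_gap_le[OF large B a0 b0 k] unfolding L E .
    qed
  qed
  have y_rate: "\<forall>k\<ge>1. ereal ((norm (y k - ys))\<^sup>2) \<le> 2 * E1 xs ys / ereal (\<mu>g * (t k)\<^sup>2)"
  proof (intro allI impI)
    fix k :: nat assume k: "k \<ge> 1"
    have "(norm (y k - ys))\<^sup>2 \<le> 2 * energy xs ys 1 / (\<mu>g * (t k)\<^sup>2)"
      using rates(4)[OF s k] tpos[OF k] g1(4) by (simp add: pos_le_divide_eq mult_ac)
    moreover have "2 * E1 xs ys = ereal (2 * energy xs ys 1)"
      unfolding Es by (metis numeral_eq_ereal times_ereal.simps(1))
    ultimately show "ereal ((norm (y k - ys))\<^sup>2) \<le> 2 * E1 xs ys / ereal (\<mu>g * (t k)\<^sup>2)"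
      using tpos[OF k] g1(4) by simp
  qed
  have v_rate: "\<forall>k\<ge>1. ereal ((norm (v k - ys))\<^sup>2)
      \<le> ereal (2 * \<beta>) * E1 xs ys / ereal ((t (k + 1))\<^sup>2)"
  proof (intro allI impI)
    fix k :: nat assume k: "k \<ge> 1"
    have "(norm (v k - ys))\<^sup>2 \<le> 2 * \<beta> * energy xs ys 1 / (t (Suc k))\<^sup>2"
      using rates(3)[OF s k] tpos[of "Suc k"] params(2)
      by (simp add: pos_le_divide_eq pos_divide_le_eq mult_ac)
    then show "ereal ((norm (v k - ys))\<^sup>2) \<le> ereal (2 * \<beta>) * E1 xs ys / ereal ((t (k + 1))\<^sup>2)"
      using tpos[of "Suc k"] by (simp add: Es)
  qed
  have limit: "\<beta> * \<mu>g > 1 + 1 / t 1 \<longrightarrow>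
     (\<forall>x' y' (r :: nat \<Rightarrow> nat). strict_mono r \<and> (\<lambda>i. (x (r i), y (r i))) \<longlonglongrightarrow> (x', y')
       \<longrightarrow> (x', y') \<in> \<Omega>)"
    using limit_point_saddle Omega_iff by blast
  show ?thesis
    using unique gap_rate pd iterates_bounded[OF s] y_rate v_rate x_increments[OF s]
      y_increments[OF s] limit by (intro conjI)
qed

end
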